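(* Let $T>0$, let $W$ and $U$ be two measurable functions on $I^2$ with $|W|\le1$, $|U|\le1$, each satisfying $$\lim_{\delta\to0}\int_I|W(x+\delta,y)-W(x,y)|\,dy=0,\qquad \lim_{\delta\to0}\int_I|U(x+\delta,y)-U(x,y)|\,dy=0\qquad\text{for all }x\in I,$$ and let $\bar\mu_0\in\bar{\mathcal M}$. Let $\bar\mu_\cdot,\bar\nu_\cdot\in\bar{\mathcal M}_{\mathcal T}$ be the unique solutions of the fixed point equations $$\bar\mu_t=\bar\mu_0\circ T_{0,t}[W,\bar\mu_\cdot],\qquad \bar\nu_t=\bar\mu_0\circ T_{0,t}[U,\bar\nu_\cdot],\qquad t\in[0,T],$$ respectively. Then $$\sup_{t\in[0,T]}\bar d(\bar\mu_t,\bar\nu_t)\le e^{2T}\|W-U\|_{L^1(I^2)} .$$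
   Context: Let $I=[0,1]$, $\mathcal{T}=[0,T]$, $\mathbb{S}=\mathbb{R}/2\pi\mathbb{Z}$ with distance $d_{\mathbb S}(\theta,\theta')=\min\{|\theta-\theta'|,2\pi-|\theta-\theta'|\}$ (representatives in $[0,2\pi)$). The limits $\delta\to0$ are over $\delta$ with $x+\delta\in I$. $\mathcal{M}$ is the space of Borel probability measures on $\mathbb{S}$ with the metric $d(\mu,\eta)=\sup_{f\in\mathcal{L}}\left|\int_{\mathbb S}f\,d\mu-\int_{\mathbb S}f\,d\eta\right|$, where $\mathcal{L}$ is the set of real-valued Lipschitz functions on $\mathbb{S}$ with Lipschitz constant at most $1$. $\bar{\mathcal M}$ is the set of measurable functions $\bar\mu:I\to\mathcal{M}$, $x\mapsto\mu^x$ (preimages of open sets are Lebesgue measurable), with functions equal a.e. identified, with the metric $\bar d(\bar\mu,\bar\eta)=\int_Id(\mu^x,\eta^x)\,dx$. $\bar{\mathcal M}_{\mathcal T}=C(\mathcal{T},\bar{\mathcal M})$ is the space of continuous $\bar{\mathcal M}$-valued functions $\bar\mu_\cdot:t\mapsto\bar\mu_t$. Standing assumption: $D:\mathbb{S}\to\mathbb{R}$ (a $2\pi$-periodic function) satisfies $\max|D|\le1$ and $|D(u)-D(v)|\le|u-v|$. For a kernel $W$ and $\bar\mu_\cdot\in\bar{\mathcal M}_{\mathcal T}$ set $$V[W,\bar\mu_\cdot](u,x,t)=\int_IW(x,y)\left\{\int_{\mathbb S}D(v-u)\,d\mu_t^y(v)\right\}dy .$$ For each $x\in I$, $T^x_{t,s}[W,\bar\mu_\cdot]:\mathbb{S}\to\mathbb{S}$,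 $t,s\in\mathcal{T}$, denotes the flow of $\frac{d}{dt}u=V[W,\bar\mu_\cdot](u,x,t)$: $T^x_{t,s}[W,\bar\mu_\cdot]u_s=u(t)$ where $u$ is the solution with $u(s)=u_s$. It is a bijection with inverse $T^x_{s,t}[W,\bar\mu_\cdot]$. The equation $\bar\mu_t=\bar\mu_0\circ T_{0,t}[W,\bar\mu_\cdot]$ means $\mu_t^x=\mu_0^x\circ T^x_{0,t}[W,\bar\mu_\cdot]$ for a.e. $x\in I$ and all $t\in\mathcal{T}$, where $(\mu_0^x\circ T_{0,t}^x)(A)=\mu_0^x(T_{0,t}^xA)$; for each admissible kernel it has a unique solution in $\bar{\mathcal M}_{\mathcal T}$. *)

theory Defs
  imports "HOL-Probability.Probability" "HOL-Library.Real_Mod"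
begin

section \<open>The circle\<close>

quotient_type circle = real / "\<lambda>x y. [x = y] (rmod (2 * pi))"
  morphisms rep_circle to_circle
  by (intro equivpI reflpI sympI transpI) (auto simp: rcong_def)

instantiation circle :: ab_group_add
begin

lift_definition zero_circle :: circle is 0 .

lift_definition plus_circle :: "circle \<Rightarrow> circle \<Rightarrow> circle" is "(+)"
  by (rule rcong_add)

lift_definition minus_circle :: "circle \<Rightarrow> circle \<Rightarrow> circle" is "(-)"
  by (rule rcong_diff)

lift_definition uminus_circle :: "circle \<Rightarrow> circle" is uminus
  using rcong_diff[of 0 0 "2 * pi"] by simp

instance
  by standard (transfer; simp add: algebra_simps)+

end

lift_definition angle :: "circle \<Rightarrow> real" is "\<lambda>x. x rmod (2 * pi)"
  by (simp add: rcong_def)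

lemma angle_bounds: "0 \<le> angle u" "angle u < 2 * pi"
  by (transfer; simp add: rmod_nonneg rmod_less)+

lemma angle_eq_iff: "angle u = angle v \<longleftrightarrow> u = v"
  by transfer (simp add: rcong_def)

lemma to_circle_angle [simp]: "to_circle (angle u) = u"
  by transfer (simp add: rcong_def)

instantiation circle :: metric_space
begin

definition dist_circle :: "circle \<Rightarrow> circle \<Rightarrow> real" where
  "dist_circle u v = min \<bar>angle u - angle v\<bar> (2 * pi - \<bar>angle u - angle v\<bar>)"

definition uniformity_circle :: "(circle \<times> circle) filter" where
  "uniformity_circle = (INF e\<in>{0<..}. principal {(x, y). dist x y < e})"

definition open_circle :: "circle set \<Rightarrow> bool" where
  "open_circle U \<longleftrightarrow> (\<forall>x\<in>U. \<forall>\<^sub>F (x', y) in uniformity. x' = x \<longrightarrow> y \<in> U)"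

instance
proof
  fix x y z :: circle
  show "dist x y = 0 \<longleftrightarrow> x = y"
    using angle_bounds[of x] angle_bounds[of y] angle_eq_iff[of x y]
    by (auto simp: dist_circle_def min_def split: if_splits)
  show "dist x y \<le> dist x z + dist y z"
    using angle_bounds[of x] angle_bounds[of y] angle_bounds[of z]
    unfolding dist_circle_def by linarith
qed (simp_all add: uniformity_circle_def open_circle_def)

end

lemma dist_circle_le_pi: "dist (u :: circle) v \<le> pi"
  unfolding dist_circle_def by linarith

lemma dist_to_circle_le: "dist (to_circle a) (to_circle b) \<le> \<bar>a - b\<bar>"
proof -
  define m n where "m = \<lfloor>a / (2 * pi)\<rfloor>" and "n = \<lfloor>b / (2 * pi)\<rfloor>"
  have ab: "angle (to_circle a) = a - 2 * pi * of_int m" "angle (to_circle b) = b - 2 * pi * of_int n"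
    by (simp_all add: angle.abs_eq rmod_def m_def n_def)
  have eq: "a - b = angle (to_circle a) - angle (to_circle b) + 2 * pi * of_int (m - n)"
    using ab by (simp add: algebra_simps)
  consider "m = n" | "m - n \<ge> 1" | "m - n \<le> -1" by linarith
  then show ?thesis
  proof cases
    case 1 then show ?thesis using eq by (simp add: dist_circle_def)
  next
    case 2
    then have "2 * pi * of_int (m - n) \<ge> 2 * pi * 1" by (intro mult_left_mono) auto
    then show ?thesis using eq angle_bounds[of "to_circle a"] angle_bounds[of "to_circle b"]
      unfolding dist_circle_def by linarith
  next
    case 3
    then have "2 * pi * of_int (m - n) \<le> 2 * pi * (-1)" by (intro mult_left_mono) auto
    then show ?thesis using eq angle_bounds[of "to_circle a"] angle_bounds[of "to_circle b"]
      unfolding dist_circle_def by linarith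
  qed
qed

lemma compact_circle: "compact (UNIV :: circle set)"
proof -
  have "continuous_on {0..2 * pi} to_circle"
    unfolding continuous_on_iff dist_real_def
    by (meson dist_to_circle_le le_less_trans)
  then have "compact (to_circle ` {0..2 * pi})"
    by (rule compact_continuous_image) simp
  moreover have "to_circle ` {0..2 * pi} = UNIV"
  proof -
    have "u \<in> to_circle ` {0..2 * pi}" for u
      using angle_bounds[of u] by (intro image_eqI[of _ _ "angle u"]) auto
    then show ?thesis by auto
  qed
  ultimately show ?thesis by simp
qed


section \<open>Borel probability measures on the circle\<close>

typedef circle_prob = "{M :: circle measure. prob_space M \<and> sets M = sets borel}"
  morphisms meas Abs_circle_prob
proof
  show "return borel 0 \<in> {M :: circle measure. prob_space M \<and> sets M = sets borel}"
    by (simp add: prob_space_return)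
qed

lemma prob_space_meas: "prob_space (meas m)"
  and sets_meas [measurable_cong]: "sets (meas m) = sets borel"
  using meas[of m] by auto

lemma space_meas [simp]: "space (meas m) = UNIV"
  using sets_eq_imp_space_eq[OF sets_meas] by simp

lemma measure_meas_UNIV [simp]: "measure (meas m) UNIV = 1"
  using prob_space.prob_space[OF prob_space_meas[of m]] by simp

lemma integrable_meas_Lipschitz:
  assumes "1-lipschitz_on UNIV f"
  shows "integrable (meas m) (f :: circle \<Rightarrow> real)"
proof -
  interpret prob_space "meas m" by (rule prob_space_meas)
  have c: "continuous_on UNIV f" using assms by (rule lipschitz_on_continuous_on)
  have "bounded (range f)"
    using compact_continuous_image[OF c compact_circle] compact_imp_bounded by blast
  then obtain B where "\<And>x. norm (f x) \<le> B" by (auto simp: bounded_iff)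
  moreover have "f \<in> borel_measurable (meas m)"
    using borel_measurable_continuous_onI[OF c] measurable_cong_sets[OF sets_meas refl] by blast
  ultimately show ?thesis by (intro integrable_const_bound[of _ B]) auto
qed

lemma Lipschitz_integral_diff_le:
  assumes f: "1-lipschitz_on UNIV (f :: circle \<Rightarrow> real)"
  shows "\<bar>(LINT v|meas m. f v) - (LINT v|meas n. f v)\<bar> \<le> 2 * pi"
proof -
  have *: "\<bar>(LINT v|meas k. f v) - f 0\<bar> \<le> pi" for k
  proof -
    interpret prob_space "meas k" by (rule prob_space_meas)
    have i: "integrable (meas k) (\<lambda>v. f v - f 0)" using integrable_meas_Lipschitz[OF f] by auto
    have "(LINT v|meas k. f v) - f 0 = (LINT v|meas k. f v - f 0)"
      using integrable_meas_Lipschitz[OF f] by simp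
    also have "\<bar>\<dots>\<bar> \<le> (LINT v|meas k. \<bar>f v - f 0\<bar>)" by (rule integral_abs_bound)
    also have "\<dots> \<le> (LINT v|meas k. pi)"
    proof (rule integral_mono)
      fix v
      show "\<bar>f v - f 0\<bar> \<le> pi"
        using lipschitz_onD[OF f, of v 0] dist_circle_le_pi[of v 0] by (simp add: dist_real_def)
    qed (use i in auto)
    finally show ?thesis by simp
  qed
  show ?thesis using *[of m] *[of n] by linarith
qed

instantiation circle_prob :: metric_space
begin

definition dist_circle_prob :: "circle_prob \<Rightarrow> circle_prob \<Rightarrow> real" where
  "dist_circle_prob m n =
     (SUP f\<in>{f :: circle \<Rightarrow> real. 1-lipschitz_on UNIV f}.
        \<bar>(LINT v|meas m. f v) - (LINT v|meas n. f v)\<bar>)"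

definition uniformity_circle_prob :: "(circle_prob \<times> circle_prob) filter" where
  "uniformity_circle_prob = (INF e\<in>{0<..}. principal {(x, y). dist x y < e})"

definition open_circle_prob :: "circle_prob set \<Rightarrow> bool" where
  "open_circle_prob U \<longleftrightarrow> (\<forall>x\<in>U. \<forall>\<^sub>F (x', y) in uniformity. x' = x \<longrightarrow> y \<in> U)"

lemma Lipschitz_integral_diff_le_dist:
  assumes f: "1-lipschitz_on UNIV (f :: circle \<Rightarrow> real)"
  shows "\<bar>(LINT v|meas m. f v) - (LINT v|meas n. f v)\<bar> \<le> dist m n"
  unfolding dist_circle_prob_def
proof (rule cSUP_upper)
  show "bdd_above ((\<lambda>f. \<bar>(LINT v|meas m. f v) - (LINT v|meas n. f v)\<bar>) `
          {f :: circle \<Rightarrow> real. 1-lipschitz_on UNIV f})"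
    by (rule bdd_aboveI2[of _ _ "2 * pi"]) (use Lipschitz_integral_diff_le in auto)
qed (use f in auto)

lemma dist_circle_prob_leI:
  assumes "\<And>f :: circle \<Rightarrow> real. 1-lipschitz_on UNIV f \<Longrightarrow>
             \<bar>(LINT v|meas m. f v) - (LINT v|meas n. f v)\<bar> \<le> c"
  shows "dist m n \<le> c"
  unfolding dist_circle_prob_def
proof (rule cSUP_least)
  have "1-lipschitz_on UNIV (\<lambda>_ :: circle. 0 :: real)" by (simp add: lipschitz_on_def)
  then show "{f :: circle \<Rightarrow> real. 1-lipschitz_on UNIV f} \<noteq> {}" by blast
qed (use assms in auto)

lemma circle_prob_eqI:
  assumes *: "\<And>f :: circle \<Rightarrow> real. 1-lipschitz_on UNIV f \<Longrightarrow>
                (LINT v|meas m. f v) = (LINT v|meas n. f v)"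
  shows "m = n"
proof -
  interpret m: prob_space "meas m" by (rule prob_space_meas)
  interpret n: prob_space "meas n" by (rule prob_space_meas)
  have cl: "measure (meas m) C = measure (meas n) C" if C: "closed C" "C \<noteq> {}" for C
  proof -
    define g where "g k x = max 0 (1 - real (Suc k) * infdist x C)" for k and x :: circle
    have lip: "1-lipschitz_on UNIV (\<lambda>x. g k x / real (Suc k))" for k
    proof (rule lipschitz_onI)
      fix x y :: circle
      have "g k x / real (Suc k) = max 0 (1 / real (Suc k) - infdist x C)" for x
      proof -
        have "1 / real (Suc k) - infdist x C = (1 - real (Suc k) * infdist x C) / real (Suc k)"
          by (simp add: diff_divide_distrib del: of_nat_Suc)
        then show ?thesis
          unfolding g_def by (auto simp: max_def zero_le_divide_iff divide_le_0_iff)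
      qed
      then show "dist (g k x / real (Suc k)) (g k y / real (Suc k)) \<le> 1 * dist x y"
        using infdist_triangle_abs[of x C y] by (auto simp: dist_real_def)
    qed simp
    have gm: "g k \<in> borel_measurable borel" for k
      unfolding g_def by (intro borel_measurable_continuous_onI continuous_intros)
    have lim: "(\<lambda>k. g k x) \<longlonglongrightarrow> indicator C x" for x
    proof (cases "x \<in> C")
      case True then show ?thesis by (simp add: g_def)
    next
      case False
      then have p: "infdist x C > 0"
        using C in_closed_iff_infdist_zero[of C x] infdist_nonneg[of x C] by force
      have "\<forall>\<^sub>F k in sequentially. real k > 1 / infdist x C"
        using filterlim_real_sequentially filterlim_at_top_dense by blast
      then have "\<forall>\<^sub>F k in sequentially. g k x = 0"
      proof eventually_elim
        case (elim k)
        then have "1 < real k * infdist x C" using p by (simp add: divide_simps)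
        also have "\<dots> \<le> real (Suc k) * infdist x C" using p by (intro mult_right_mono) auto
        finally show ?case by (simp add: g_def)
      qed
      then show ?thesis using False by (simp add: tendsto_eventually)
    qed
    have bd: "norm (g k x) \<le> 1" for k x
      using infdist_nonneg[of x C] mult_nonneg_nonneg[of "real (Suc k)" "infdist x C"]
      by (simp add: g_def)
    have conv: "(\<lambda>k. LINT v|meas p. g k v) \<longlonglongrightarrow> measure (meas p) C" for p
    proof -
      interpret p: prob_space "meas p" by (rule prob_space_meas)
      have Cs: "C \<in> sets (meas p)" using C by (simp add: sets_meas)
      have "(\<lambda>k. LINT v|meas p. g k v) \<longlonglongrightarrow> (LINT v|meas p. indicator C v)"
      proof (rule integral_dominated_convergence[where w = "\<lambda>_. 1"])
        show "g k \<in> borel_measurable (meas p)" for k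
          using gm measurable_cong_sets[OF sets_meas refl] by blast
        show "indicat_real C \<in> borel_measurable (meas p)" using Cs by simp
      qed (use lim bd in auto)
      then show ?thesis using Cs by simp
    qed
    have "(LINT v|meas m. g k v) = (LINT v|meas n. g k v)" for k
      using *[OF lip[of k]] by simp
    then show ?thesis using conv[of m] conv[of n] LIMSEQ_unique by auto
  qed
  have "meas m = meas n"
  proof (rule measure_eqI_generator_eq[where E = "Collect closed" and \<Omega> = UNIV and A = "\<lambda>_. UNIV"])
    show "Int_stable (Collect (closed :: circle set \<Rightarrow> bool))" by (auto simp: Int_stable_def)
    show "emeasure (meas m) X = emeasure (meas n) X" if "X \<in> Collect closed" for X
      using cl[of X] that by (cases "X = {}") (auto simp: m.emeasure_eq_measure n.emeasure_eq_measure)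
    show "sets (meas m) = sigma_sets UNIV (Collect closed)"
      "sets (meas n) = sigma_sets UNIV (Collect closed)"
      by (simp_all add: sets_meas borel_eq_closed)
  qed auto
  then show ?thesis by (simp add: meas_inject)
qed

instance
proof
  fix x y z :: circle_prob
  show "dist x y = 0 \<longleftrightarrow> x = y"
  proof
    assume "dist x y = 0"
    then show "x = y"
      using Lipschitz_integral_diff_le_dist[of _ x y] by (intro circle_prob_eqI) fastforce
  next
    assume "x = y"
    moreover have "1-lipschitz_on UNIV (\<lambda>_ :: circle. 0 :: real)" by (simp add: lipschitz_on_def)
    ultimately show "dist x y = 0"
      using Lipschitz_integral_diff_le_dist[of "\<lambda>_. 0" x y] dist_circle_prob_leI[of x y 0] by force
  qed
  show "dist x y \<le> dist x z + dist y z"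
  proof (rule dist_circle_prob_leI)
    fix f :: "circle \<Rightarrow> real" assume f: "1-lipschitz_on UNIV f"
    show "\<bar>(LINT v|meas x. f v) - (LINT v|meas y. f v)\<bar> \<le> dist x z + dist y z"
      using Lipschitz_integral_diff_le_dist[OF f, of x z] Lipschitz_integral_diff_le_dist[OF f, of y z]
      by linarith
  qed
qed (simp_all add: uniformity_circle_prob_def open_circle_prob_def)

end

lemma dist_circle_prob_le: "dist (m :: circle_prob) n \<le> 2 * pi"
  by (intro dist_circle_prob_leI Lipschitz_integral_diff_le)

lemma borel_measurable_integral_Lipschitz:
  assumes f: "1-lipschitz_on UNIV (f :: circle \<Rightarrow> real)"
  shows "(\<lambda>m. LINT v|meas m. f v) \<in> borel_measurable borel"
proof -
  have "1-lipschitz_on UNIV (\<lambda>m. LINT v|meas m. f v)"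
    using Lipschitz_integral_diff_le_dist[OF f] by (intro lipschitz_onI) (auto simp: dist_real_def)
  then show ?thesis by (intro borel_measurable_continuous_onI lipschitz_on_continuous_on)
qed

lemma countable_dense_Lipschitz:
  obtains F :: "(circle \<Rightarrow> real) set" where "countable F" "F \<noteq> {}"
    "\<And>f. f \<in> F \<Longrightarrow> 1-lipschitz_on UNIV f"
    "\<And>f e. 1-lipschitz_on UNIV f \<Longrightarrow> e > 0 \<Longrightarrow> \<exists>g\<in>F. \<forall>x. \<bar>f x - g x\<bar> \<le> e"
proof -
  define G where "G L = (\<lambda>x. Min ((\<lambda>(p, q). of_rat q + dist x (to_circle (of_rat p))) ` set L))"
    for L :: "(rat \<times> rat) list"
  have lip: "1-lipschitz_on UNIV (G L)" if "L \<noteq> []" for L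
  proof -
    have le: "G L x \<le> G L y + dist x y" for x y
    proof -
      have "G L y \<in> (\<lambda>(p, q). of_rat q + dist y (to_circle (of_rat p))) ` set L"
        unfolding G_def using that by (intro Min_in) auto
      then obtain p q where pq: "(p, q) \<in> set L" "G L y = of_rat q + dist y (to_circle (of_rat p))"
        by auto
      have "G L x \<le> of_rat q + dist x (to_circle (of_rat p))"
        unfolding G_def using pq by (intro Min_le) force+
      also have "\<dots> \<le> G L y + dist x y"
        using pq dist_triangle[of x "to_circle (of_rat p)" y] by simp
      finally show ?thesis .
    qed
    show ?thesis
    proof (rule lipschitz_onI)
      fix x y
      show "dist (G L x) (G L y) \<le> 1 * dist x y"
        using le[of x y] le[of y x] by (auto simp: dist_real_def dist_commute)
    qed simp
  qed
  have dense: "\<exists>L. L \<noteq> [] \<and> (\<forall>x. \<bar>f x - G L x\<bar> \<le> e)"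
    if f: "1-lipschitz_on UNIV f" and e: "e > 0" for f e
  proof -
    define d where "d = e / 3"
    have d: "d > 0" using e by (simp add: d_def)
    have "UNIV \<subseteq> (\<Union>p::rat. ball (to_circle (of_rat p)) d)"
    proof
      fix u :: circle
      obtain r where r: "r \<in> \<rat>" "angle u < r" "r < angle u + d"
        using Rats_dense_in_real[of "angle u" "angle u + d"] d by auto
      then obtain p where "r = of_rat p" by (auto elim: Rats_cases)
      moreover have "dist (to_circle r) u < d"
        using dist_to_circle_le[of r "angle u"] r by simp
      ultimately show "u \<in> (\<Union>p::rat. ball (to_circle (of_rat p)) d)" by auto
    qed
    then obtain P :: "rat set" where P: "finite P" "UNIV \<subseteq> (\<Union>p\<in>P. ball (to_circle (of_rat p)) d)"
      using compactE_image[OF compact_circle, of UNIV "\<lambda>p::rat. ball (to_circle (of_rat p)) d"]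
      by (metis open_ball)
    have "\<exists>q::rat. f (to_circle (of_rat p)) < of_rat q \<and> of_rat q < f (to_circle (of_rat p)) + d" for p :: rat
      using of_rat_dense[of "f (to_circle (of_rat p))" "f (to_circle (of_rat p)) + d"] d by auto
    then obtain q :: "rat \<Rightarrow> rat" where
      q: "\<And>p. f (to_circle (of_rat p)) < of_rat (q p)" "\<And>p. of_rat (q p) < f (to_circle (of_rat p)) + d"
      by metis
    obtain ps where ps: "set ps = P" using P finite_list by blast
    define L where "L = map (\<lambda>p. (p, q p)) ps"
    have "P \<noteq> {}" using P by auto
    then have L: "L \<noteq> []" using ps by (auto simp: L_def)
    have lipf: "\<bar>f x - f y\<bar> \<le> dist x y" for x y
      using lipschitz_onD[OF f, of x y] by (simp add: dist_real_def)
    have "\<bar>f x - G L x\<bar> \<le> e" for x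
    proof -
      have "f x \<le> G L x"
      proof -
        have "G L x \<in> (\<lambda>(p, q). of_rat q + dist x (to_circle (of_rat p))) ` set L"
          unfolding G_def using L by (intro Min_in) auto
        then obtain p where "G L x = of_rat (q p) + dist x (to_circle (of_rat p))"
          by (auto simp: L_def)
        then show ?thesis using q(1)[of p] lipf[of x "to_circle (of_rat p)"] by linarith
      qed
      moreover have "G L x \<le> f x + e"
      proof -
        obtain p where p: "p \<in> P" "dist (to_circle (of_rat p)) x < d"
          using P(2) by (auto simp: subset_eq)
        have "G L x \<le> of_rat (q p) + dist x (to_circle (of_rat p))"
          unfolding G_def using p ps by (intro Min_le) (force simp: L_def)+
        then show ?thesis
          using p(2) q(2)[of p] lipf[of "to_circle (of_rat p)" x]
          by (simp add: dist_commute d_def)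
      qed
      ultimately show ?thesis using e by linarith
    qed
    then show ?thesis using L by blast
  qed
  show thesis
  proof (rule that[of "G ` {L. L \<noteq> []}"])
    show "countable (G ` {L. L \<noteq> []})" by simp
    show "G ` {L. L \<noteq> []} \<noteq> {}" by blast
    show "1-lipschitz_on UNIV f" if "f \<in> G ` {L. L \<noteq> []}" for f using that lip by blast
    show "\<exists>g\<in>G ` {L. L \<noteq> []}. \<forall>x. \<bar>f x - g x\<bar> \<le> e"
      if "1-lipschitz_on UNIV f" "e > 0" for f e
      using dense[OF that] by blast
  qed
qed

lemma borel_measurable_dist_circle_prob:
  fixes \<mu> \<eta> :: "'a \<Rightarrow> circle_prob"
  assumes [measurable]: "\<mu> \<in> borel_measurable M" "\<eta> \<in> borel_measurable M"
  shows "(\<lambda>x. dist (\<mu> x) (\<eta> x)) \<in> borel_measurable M"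
proof -
  obtain F :: "(circle \<Rightarrow> real) set" where F: "countable F" "F \<noteq> {}"
    "\<And>f. f \<in> F \<Longrightarrow> 1-lipschitz_on UNIV f"
    "\<And>f e. 1-lipschitz_on UNIV f \<Longrightarrow> e > 0 \<Longrightarrow> \<exists>g\<in>F. \<forall>x. \<bar>f x - g x\<bar> \<le> e"
    using countable_dense_Lipschitz by metis
  let ?I = "\<lambda>f m n. \<bar>(LINT v|meas m. f v) - (LINT v|meas n. f v)\<bar>"
  have bdd: "bdd_above ((\<lambda>f. ?I f m n) ` F)" for m n
    by (rule bdd_aboveI2[of _ _ "2 * pi"]) (use F Lipschitz_integral_diff_le in auto)
  have eq: "dist m n = (SUP f\<in>F. ?I f m n)" for m n
  proof (rule antisym)
    show "(SUP f\<in>F. ?I f m n) \<le> dist m n"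
      using F by (intro cSUP_least Lipschitz_integral_diff_le_dist) auto
    show "dist m n \<le> (SUP f\<in>F. ?I f m n)"
    proof (rule dist_circle_prob_leI)
      fix f :: "circle \<Rightarrow> real" assume f: "1-lipschitz_on UNIV f"
      show "?I f m n \<le> (SUP f\<in>F. ?I f m n)"
      proof (rule field_le_epsilon)
        fix e :: real assume e: "e > 0"
        then obtain g where g: "g \<in> F" "\<And>x. \<bar>f x - g x\<bar> \<le> e / 2"
          using F(4)[OF f, of "e / 2"] by auto
        have *: "\<bar>(LINT v|meas k. f v) - (LINT v|meas k. g v)\<bar> \<le> e / 2" for k
        proof -
          interpret prob_space "meas k" by (rule prob_space_meas)
          have i: "integrable (meas k) f" "integrable (meas k) g"
            using f F g integrable_meas_Lipschitz by auto
          have "\<bar>(LINT v|meas k. f v) - (LINT v|meas k. g v)\<bar> = \<bar>LINT v|meas k. f v - g v\<bar>"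
            using i by simp
          also have "\<dots> \<le> (LINT v|meas k. \<bar>f v - g v\<bar>)" by (rule integral_abs_bound)
          also have "\<dots> \<le> (LINT v|meas k. e / 2)" using g i by (intro integral_mono) auto
          finally show ?thesis by simp
        qed
        have "?I f m n \<le> ?I g m n + e" using *[of m] *[of n] by linarith
        also have "?I g m n \<le> (SUP f\<in>F. ?I f m n)" using g bdd by (intro cSUP_upper)
        finally show "?I f m n \<le> (SUP f\<in>F. ?I f m n) + e" by simp
      qed
    qed
  qed
  show ?thesis unfolding eq
  proof (rule borel_measurable_cSUP)
    fix f assume "f \<in> F"
    then have [measurable]: "(\<lambda>m. LINT v|meas m. f v) \<in> borel_measurable borel"
      using F borel_measurable_integral_Lipschitz by blast
    show "(\<lambda>x. ?I f (\<mu> x) (\<eta> x)) \<in> borel_measurable M" by measurable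
  qed (use F bdd in auto)
qed


section \<open>Measurable families of probability measures over the unit interval\<close>

text \<open>Functions \<open>I \<rightarrow> \<M>\<close> are represented by functions on all of \<open>\<real>\<close>; their values outside
  the unit interval are irrelevant, being identified by the quotient.\<close>

definition ae_eq :: "(real \<Rightarrow> circle_prob) \<Rightarrow> (real \<Rightarrow> circle_prob) \<Rightarrow> bool" where
  "ae_eq \<mu> \<eta> \<longleftrightarrow> \<mu> \<in> borel_measurable (lebesgue_on {0..1}) \<and> \<eta> \<in> borel_measurable (lebesgue_on {0..1}) \<and>
     (AE x in lebesgue_on {0..1}. \<mu> x = \<eta> x)"

quotient_type prob_family = "real \<Rightarrow> circle_prob" / partial: ae_eq
  morphisms fibre Abs_prob_family
proof (rule part_equivpI)
  show "\<exists>x. ae_eq x x" by (rule exI[of _ "\<lambda>_. undefined"]) (simp add: ae_eq_def)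
  show "symp ae_eq" unfolding symp_def ae_eq_def by (auto elim: AE_mp)
  show "transp ae_eq"
    unfolding transp_def ae_eq_def
  proof (intro allI impI conjI; elim conjE)
    fix x y z :: "real \<Rightarrow> circle_prob"
    assume "AE t in lebesgue_on {0..1}. x t = y t" "AE t in lebesgue_on {0..1}. y t = z t"
    then show "AE t in lebesgue_on {0..1}. x t = z t" by eventually_elim simp
  qed
qed

lemma finite_measure_lebesgue_on_unit: "finite_measure (lebesgue_on {0..1 :: real})"
  by (rule finite_measureI) (simp add: emeasure_restrict_space space_restrict_space)

lemma integrable_dist_circle_prob:
  assumes "\<mu> \<in> borel_measurable (lebesgue_on {0..1})" "\<eta> \<in> borel_measurable (lebesgue_on {0..1})"
  shows "integrable (lebesgue_on {0..1 :: real}) (\<lambda>x. dist (\<mu> x) (\<eta> x :: circle_prob))"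
proof -
  interpret finite_measure "lebesgue_on {0..1 :: real}" by (rule finite_measure_lebesgue_on_unit)
  show ?thesis
    using borel_measurable_dist_circle_prob[OF assms] dist_circle_prob_le
    by (intro integrable_const_bound[of _ "2 * pi"]) auto
qed

instantiation prob_family :: metric_space
begin

lift_definition dist_prob_family :: "prob_family \<Rightarrow> prob_family \<Rightarrow> real" is
  "\<lambda>\<mu> \<eta>. LINT x|lebesgue_on {0..1}. dist (\<mu> x) (\<eta> x)"
proof -
  fix a b c d assume *: "ae_eq a b" "ae_eq c d"
  then have "AE x in lebesgue_on {0..1}. a x = b x" "AE x in lebesgue_on {0..1}. c x = d x"
    by (auto simp: ae_eq_def)
  then have "AE x in lebesgue_on {0..1}. dist (a x) (c x) = dist (b x) (d x)"
    by eventually_elim simp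
  then show "(LINT x|lebesgue_on {0..1}. dist (a x) (c x)) = (LINT x|lebesgue_on {0..1}. dist (b x) (d x))"
    using * borel_measurable_dist_circle_prob by (intro integral_cong_AE) (auto simp: ae_eq_def)
qed

definition uniformity_prob_family :: "(prob_family \<times> prob_family) filter" where
  "uniformity_prob_family = (INF e\<in>{0<..}. principal {(x, y). dist x y < e})"

definition open_prob_family :: "prob_family set \<Rightarrow> bool" where
  "open_prob_family U \<longleftrightarrow> (\<forall>x\<in>U. \<forall>\<^sub>F (x', y) in uniformity. x' = x \<longrightarrow> y \<in> U)"

instance
proof
  fix x y z :: prob_family
  show "dist x y = 0 \<longleftrightarrow> x = y"
  proof transfer
    fix a b assume "ae_eq a a" "ae_eq b b"
    then have m: "a \<in> borel_measurable (lebesgue_on {0..1})" "b \<in> borel_measurable (lebesgue_on {0..1})"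
      by (auto simp: ae_eq_def)
    show "(LINT x|lebesgue_on {0..1}. dist (a x) (b x)) = 0 \<longleftrightarrow> ae_eq a b"
      using m integral_nonneg_eq_0_iff_AE[OF integrable_dist_circle_prob[OF m]] by (simp add: ae_eq_def)
  qed
  show "dist x y \<le> dist x z + dist y z"
  proof transfer
    fix a b c assume "ae_eq a a" "ae_eq b b" "ae_eq c c"
    then have m: "a \<in> borel_measurable (lebesgue_on {0..1})" "b \<in> borel_measurable (lebesgue_on {0..1})"
      "c \<in> borel_measurable (lebesgue_on {0..1})"
      by (auto simp: ae_eq_def)
    note i = integrable_dist_circle_prob[OF m(1) m(2)] integrable_dist_circle_prob[OF m(1) m(3)]
      integrable_dist_circle_prob[OF m(2) m(3)]
    have "(LINT x|lebesgue_on {0..1}. dist (a x) (b x))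
        \<le> (LINT x|lebesgue_on {0..1}. dist (a x) (c x) + dist (b x) (c x))"
      using i dist_triangle2 by (intro integral_mono) auto
    also have "\<dots> = (LINT x|lebesgue_on {0..1}. dist (a x) (c x)) + (LINT x|lebesgue_on {0..1}. dist (b x) (c x))"
      using i by simp
    finally show "(LINT x|lebesgue_on {0..1}. dist (a x) (b x))
        \<le> (LINT x|lebesgue_on {0..1}. dist (a x) (c x)) + (LINT x|lebesgue_on {0..1}. dist (b x) (c x))" .
  qed
qed (simp_all add: uniformity_prob_family_def open_prob_family_def)

end


section \<open>Kernels, velocity field, characteristic flow\<close>

text \<open>Lebesgue measurability on the unit square alone leaves null sets of sections unconstrained,
  and \<open>integral\<^sup>L\<close> of a non-measurable function is \<open>0\<close>.  Measurability of every section is what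
  gives the integrals over \<open>y\<close> below their meaning for all \<open>x\<close>.\<close>

definition admissible_kernel :: "(real \<times> real \<Rightarrow> real) \<Rightarrow> bool" where
  "admissible_kernel W \<longleftrightarrow>
     W \<in> borel_measurable (lebesgue_on ({0..1} \<times> {0..1})) \<and>
     (\<forall>x\<in>{0..1}. (\<lambda>y. W (x, y)) \<in> borel_measurable (lebesgue_on {0..1})) \<and>
     (\<forall>x\<in>{0..1}. \<forall>y\<in>{0..1}. \<bar>W (x, y)\<bar> \<le> 1) \<and>
     (\<forall>x\<in>{0..1}. ((\<lambda>\<delta>. LINT y|lebesgue_on {0..1}. \<bar>W (x + \<delta>, y) - W (x, y)\<bar>) \<longlongrightarrow> 0)
        (at 0 within {\<delta>. x + \<delta> \<in> {0..1}}))"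

text \<open>A curve \<open>\<mu> :: real \<Rightarrow> prob_family\<close> is only used at times in \<open>[0, T]\<close>; \<open>fibre (\<mu> t) y\<close> is the
  value at \<open>y\<close> of a representative of the class \<open>\<mu> t\<close>.\<close>

definition velocity ::
  "(circle \<Rightarrow> real) \<Rightarrow> (real \<times> real \<Rightarrow> real) \<Rightarrow> (real \<Rightarrow> prob_family) \<Rightarrow> circle \<Rightarrow> real \<Rightarrow> real \<Rightarrow> real" where
  "velocity D W \<mu> u x t =
     (LINT y|lebesgue_on {0..1}. W (x, y) * (LINT v|meas (fibre (\<mu> t) y). D (v - u)))"

text \<open>The differential equation for a curve in the circle is understood through a real-valued lift.\<close>

definition characteristic ::
  "(circle \<Rightarrow> real) \<Rightarrow> real \<Rightarrow> (real \<times> real \<Rightarrow> real) \<Rightarrow> (real \<Rightarrow> prob_family) \<Rightarrow> real \<Rightarrow> (real \<Rightarrow> circle) \<Rightarrow> bool" where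
  "characteristic D T W \<mu> x u \<longleftrightarrow>
     (\<exists>\<theta>. \<forall>t\<in>{0..T}. u t = to_circle (\<theta> t) \<and>
        (\<theta> has_real_derivative velocity D W \<mu> (u t) x t) (at t within {0..T}))"

definition flow ::
  "(circle \<Rightarrow> real) \<Rightarrow> real \<Rightarrow> (real \<times> real \<Rightarrow> real) \<Rightarrow> (real \<Rightarrow> prob_family) \<Rightarrow> real \<Rightarrow> real \<Rightarrow> real \<Rightarrow> circle \<Rightarrow> circle" where
  "flow D T W \<mu> x t s u\<^sub>s = (THE w. \<exists>u. characteristic D T W \<mu> x u \<and> u s = u\<^sub>s \<and> u t = w)"

definition fixed_point_solution ::
  "(circle \<Rightarrow> real) \<Rightarrow> real \<Rightarrow> (real \<times> real \<Rightarrow> real) \<Rightarrow> prob_family \<Rightarrow> (real \<Rightarrow> prob_family) \<Rightarrow> bool" where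
  "fixed_point_solution D T W \<mu>\<^sub>0 \<mu> \<longleftrightarrow>
     continuous_on {0..T} \<mu> \<and>
     (\<forall>t\<in>{0..T}. AE x in lebesgue_on {0..1}. \<forall>A\<in>sets borel.
        emeasure (meas (fibre (\<mu> t) x)) A = emeasure (meas (fibre \<mu>\<^sub>0 x)) (flow D T W \<mu> x 0 t ` A))"

end

theory Submission
  imports Defs
begin

text \<open>
  Write \<open>r t\<close> for the distance between \<open>\<mu> t\<close> and \<open>\<nu> t\<close>, \<open>w x\<close> for the integral of \<open>\<bar>W - U\<bar>\<close> over the
  section at \<open>x\<close>, and \<open>c\<close> for the integral of \<open>w\<close>, that is the \<open>L\<^sup>1\<close> distance of the kernels.

  The fibres of \<open>\<mu> t\<close> and \<open>\<nu> t\<close> at \<open>x\<close> are images of the same initial measure under the flows of the two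
  velocity fields, so their distance is at most the largest distance at time \<open>t\<close> of two characteristics
  with a common initial value (\<open>dist_pushforward_le\<close>). The velocities are Lipschitz in the phase
  with constant \<open>1\<close> and see the family of measures through an average over the interval with weights
  of modulus at most \<open>1\<close>, so along two characteristics they differ at time \<open>s\<close> by at most the distance of the characteristics plus
  \<open>r s + w x\<close> (\<open>velocity_diff_le\<close>).

  Instead of applying Gronwall's inequality twice, once to the characteristics and once to \<open>r\<close>, let \<open>M\<close>
  be the maximum over \<open>[0, T]\<close> of the continuous function \<open>r t * exp (-2 * t)\<close>. Inserting
  \<open>r s \<le> M * exp (2 * s)\<close> in the first Gronwall estimate (\<open>lift_solution_stability\<close>) and integrating over
  \<open>x\<close> by Fubini's theorem gives
  \<open>r t \<le> M * (exp (2 * t) - exp t) + c * (exp t - 1)\<close>. At a time where the maximum is attained, the left-hand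
  side is \<open>M * exp (2 * t)\<close>; hence \<open>M \<le> c\<close>, and \<open>r t \<le> c * exp (2 * t)\<close> at all times.

  For the flow to be a bijection of the circle with the expected inverse, the characteristic equation must be
  uniquely solvable on all of \<open>[0, T]\<close> from any initial time. This is Picard's theorem
  (\<open>Lipschitz_ode_exists\<close>, \<open>Lipschitz_ode_unique\<close>), applied to real-valued lifts.
\<close>

section \<open>Scalar differential equations with Lipschitz right-hand side\<close>

lemma abs_increment_le:
  fixes h k :: "real \<Rightarrow> real"
  assumes ab: "a \<le> b" "{a..b} \<subseteq> {0..T}"
    and h: "\<And>t. t \<in> {0..T} \<Longrightarrow> (h has_real_derivative h' t) (at t within {0..T})"
    and k: "\<And>t. t \<in> {0..T} \<Longrightarrow> (k has_real_derivative k' t) (at t within {a..b})"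
    and le: "\<And>t. t \<in> {a..b} \<Longrightarrow> \<bar>h' t\<bar> \<le> k' t"
  shows "\<bar>h b - h a\<bar> \<le> k b - k a"
proof (cases "a = b")
  case False
  then have "a < b" using ab by simp
  have h1: "(h has_real_derivative h' t) (at t within {a..b})" if "t \<in> {a..b}" for t
    using h[of t] that ab by (auto intro: DERIV_subset)
  have k1: "(k has_real_derivative k' t) (at t within {a..b})" if "t \<in> {a..b}" for t
    using k[of t] that ab by auto
  have "norm (h b - h a) \<le> k b - k a"
  proof (rule differentiable_bound_general[OF \<open>a < b\<close>])
    show "continuous_on {a..b} h" "continuous_on {a..b} k"
      using h1 k1 by (blast intro: DERIV_continuous_on)+
    fix x assume "a < x" "x < b"
    then have "x \<in> {a..b}" "at x within {a..b} = at x" by (auto simp: at_within_Icc_at)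
    then show "(h has_vector_derivative h' x) (at x)" "(k has_vector_derivative k' x) (at x)"
      "norm (h' x) \<le> k' x"
      using h1[of x] k1[of x] le[of x]
      by (auto simp: has_real_derivative_iff_has_vector_derivative)
  qed
  then show ?thesis by simp
qed simp

text \<open>Integrating \<open>exp (2 * \<bar>r - s\<bar>)\<close> away from \<open>s\<close> gains the factor \<open>1/2\<close>: in the supremum norm with this
  weight, the integral operator of an equation with Lipschitz constant \<open>1\<close> is a contraction on
  the whole interval, in both time directions. Existence and uniqueness below both rest on this.\<close>

lemma exp_weighted_increment_le:
  fixes h :: "real \<Rightarrow> real"
  assumes s: "s \<in> {0..T}" and t: "t \<in> {0..T}" and K: "K \<ge> 0"
    and h: "\<And>t. t \<in> {0..T} \<Longrightarrow> (h has_real_derivative h' t) (at t within {0..T})"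
    and le: "\<And>t. t \<in> {0..T} \<Longrightarrow> \<bar>h' t\<bar> \<le> K * exp (2 * \<bar>t - s\<bar>)"
  shows "\<bar>h t - h s\<bar> \<le> K / 2 * exp (2 * \<bar>t - s\<bar>)"
proof (cases "s \<le> t")
  case True
  have "\<bar>h t - h s\<bar> \<le> K / 2 * exp (2 * (t - s)) - K / 2 * exp (2 * (s - s))"
  proof (rule abs_increment_le[OF True _ h, where k' = "\<lambda>r. K * exp (2 * (r - s))"])
    show "\<bar>h' r\<bar> \<le> K * exp (2 * (r - s))" if "r \<in> {s..t}" for r
      using le[of r] that s t by simp
  qed (use s t in \<open>auto intro!: derivative_eq_intros\<close>)
  then show ?thesis using True K by simp
next
  case False
  have "\<bar>h s - h t\<bar> \<le> - (K / 2 * exp (2 * (s - s))) - - (K / 2 * exp (2 * (s - t)))"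
  proof (rule abs_increment_le[OF _ _ h, where k' = "\<lambda>r. K * exp (2 * (s - r))"])
    show "\<bar>h' r\<bar> \<le> K * exp (2 * (s - r))" if "r \<in> {t..s}" for r
      using le[of r] that s t by (simp add: abs_minus_commute)
  qed (use s t False in \<open>auto intro!: derivative_eq_intros\<close>)
  then have "\<bar>h t - h s\<bar> \<le> K / 2 * exp (2 * (s - t)) - K / 2"
    by (simp add: abs_minus_commute)
  then show ?thesis using False K by simp
qed

text \<open>Picard's theorem through the contraction principle. Instead of reweighting the norm, the unknown is
  divided by the weight: a fixed point \<open>g\<close> is sought among the bounded continuous functions, and
  the solution is \<open>exp (2 * \<bar>t - s\<bar>) * g t\<close>. The initial time \<open>s\<close> is arbitrary, since the flow of
  the characteristics has to be inverted.\<close>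

lemma Lipschitz_ode_exists:
  fixes F :: "real \<Rightarrow> real \<Rightarrow> real"
  assumes T: "T \<ge> 0" and s: "s \<in> {0..T}"
    and lip: "\<And>t a b. t \<in> {0..T} \<Longrightarrow> \<bar>F t a - F t b\<bar> \<le> \<bar>a - b\<bar>"
    and cont: "\<And>a. continuous_on {0..T} (\<lambda>t. F t a)"
  obtains \<theta> where "\<theta> s = a" "\<And>t. t \<in> {0..T} \<Longrightarrow> (\<theta> has_real_derivative F t (\<theta> t)) (at t within {0..T})"
proof -
  define e where "e t = exp (2 * \<bar>t - s\<bar>)" for t
  \<comment> \<open>Points outside the time interval are projected onto it, so that the operator
    acts on functions on the whole line.\<close>
  define c where "c t = max 0 (min T t)" for t
  have c: "c t \<in> {0..T}" for t using T by (auto simp: c_def)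
  have c_id: "c t = t" if "t \<in> {0..T}" for t using that by (auto simp: c_def)
  have e_pos: "e t > 0" for t by (simp add: e_def)
  have e_cont: "continuous_on A e" for A unfolding e_def by (intro continuous_intros)
  define f where "f g t = F t (e t * apply_bcontfun g t)" for g :: "real \<Rightarrow>\<^sub>C real" and t
  \<comment> \<open>Continuity in time for every fixed state and the Lipschitz condition give joint continuity.\<close>
  have comp: "continuous_on {0..T} (\<lambda>t. F t (k t))" if k: "continuous_on {0..T} k" for k
    unfolding continuous_on_def
  proof
    fix t assume t: "t \<in> {0..T}"
    have "((\<lambda>r. F r (k t) + (F r (k r) - F r (k t))) \<longlongrightarrow> F t (k t) + 0) (at t within {0..T})"
    proof (rule tendsto_add)
      show "((\<lambda>r. F r (k t)) \<longlongrightarrow> F t (k t)) (at t within {0..T})"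
        using cont[of "k t"] t by (auto simp: continuous_on_def)
      have lim: "((\<lambda>r. \<bar>k r - k t\<bar>) \<longlongrightarrow> 0) (at t within {0..T})"
        using k t by (auto simp: continuous_on_def LIM_zero_iff intro!: tendsto_rabs_zero)
      show "((\<lambda>r. F r (k r) - F r (k t)) \<longlongrightarrow> 0) (at t within {0..T})"
        by (rule Lim_null_comparison[OF _ lim]) (auto simp: eventually_at_filter lip)
    qed
    then show "((\<lambda>r. F r (k r)) \<longlongrightarrow> F t (k t)) (at t within {0..T})" by simp
  qed
  have f_cont: "continuous_on {0..T} (f g)" for g
    unfolding f_def by (intro comp continuous_intros e_cont) auto
  define J where "J g t = integral {0..t} (f g)" for g t
  have J_deriv: "(J g has_real_derivative f g t) (at t within {0..T})" if "t \<in> {0..T}" for g t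
    unfolding J_def by (rule integral_has_real_derivative[OF f_cont that])
  define P where "P g t = (a + (J g (c t) - J g s)) / e (c t)" for g t
  have P_cont: "P g \<in> bcontfun" for g
  proof -
    have J: "continuous_on {0..T} (J g)" using J_deriv by (blast intro: DERIV_continuous_on)
    then have Q: "continuous_on {0..T} (\<lambda>t. (a + (J g t - J g s)) / e t)"
      by (intro continuous_intros e_cont) (simp_all add: e_def)
    have cc: "continuous_on UNIV c" unfolding c_def by (intro continuous_intros)
    have "continuous_on UNIV (P g)"
      unfolding P_def by (rule continuous_on_compose2[OF Q cc]) (use c in auto)
    moreover have "bounded (range (P g))"
    proof (rule bounded_subset)
      show "bounded ((\<lambda>t. (a + (J g t - J g s)) / e t) ` {0..T})"
        by (intro compact_imp_bounded compact_continuous_image Q) simp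
      show "range (P g) \<subseteq> (\<lambda>t. (a + (J g t - J g s)) / e t) ` {0..T}"
        using c by (auto simp: P_def)
    qed
    ultimately show ?thesis by (simp add: bcontfun_def)
  qed
  have contr: "dist (Bcontfun (P g)) (Bcontfun (P h)) \<le> 1 / 2 * dist g h" for g h
  proof (rule dist_bound)
    fix r
    define t where "t = c r"
    have t: "t \<in> {0..T}" using c by (simp add: t_def)
    have "\<bar>(J g t - J h t) - (J g s - J h s)\<bar> \<le> dist g h / 2 * exp (2 * \<bar>t - s\<bar>)"
    proof (rule exp_weighted_increment_le[OF s t])
      show "((\<lambda>t. J g t - J h t) has_real_derivative f g t - f h t) (at t within {0..T})"
        if "t \<in> {0..T}" for t
        using J_deriv[OF that] by (intro derivative_intros)
      show "\<bar>f g t - f h t\<bar> \<le> dist g h * exp (2 * \<bar>t - s\<bar>)" if t: "t \<in> {0..T}" for t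
      proof -
        have "\<bar>f g t - f h t\<bar> \<le> \<bar>e t * apply_bcontfun g t - e t * apply_bcontfun h t\<bar>"
          unfolding f_def by (rule lip[OF t])
        also have "\<dots> = e t * dist (apply_bcontfun g t) (apply_bcontfun h t)"
          using e_pos[of t] by (simp add: dist_real_def abs_mult flip: right_diff_distrib)
        also have "\<dots> \<le> e t * dist g h"
          using e_pos[of t] by (intro mult_left_mono dist_bounded) auto
        finally show ?thesis by (simp add: e_def mult.commute)
      qed
    qed simp
    then have "\<bar>P g r - P h r\<bar> \<le> dist g h / 2"
      using e_pos[of t] unfolding P_def t_def[symmetric]
      by (simp add: e_def flip: diff_divide_distrib) (simp add: divide_simps algebra_simps abs_if split: if_splits)
    then show "dist (apply_bcontfun (Bcontfun (P g)) r) (apply_bcontfun (Bcontfun (P h)) r)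
        \<le> 1 / 2 * dist g h"
      by (simp add: Bcontfun_inverse P_cont dist_real_def)
  qed
  obtain g where g: "Bcontfun (P g) = g"
    using banach_fix_type[of "1/2" "\<lambda>g. Bcontfun (P g)"] contr by auto
  define \<theta> where "\<theta> t = a + (J g t - J g s)" for t
  have \<theta>: "e t * apply_bcontfun g t = \<theta> t" if "t \<in> {0..T}" for t
  proof -
    have "apply_bcontfun g t = P g t" using g P_cont[of g] by (metis Bcontfun_inverse)
    then show ?thesis using e_pos[of t] that by (simp add: P_def c_id \<theta>_def)
  qed
  show thesis
  proof (rule that)
    show "\<theta> s = a" by (simp add: \<theta>_def)
    fix t assume t: "t \<in> {0..T}"
    have "(\<theta> has_real_derivative f g t) (at t within {0..T})"
      unfolding \<theta>_def using J_deriv[OF t, of g] by (auto intro!: derivative_eq_intros)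
    then show "(\<theta> has_real_derivative F t (\<theta> t)) (at t within {0..T})"
      using \<theta>[OF t] by (simp add: f_def)
  qed
qed

text \<open>At a maximum \<open>m\<close> of the weighted modulus \<open>g\<close> the weighted increment bound
  yields \<open>g m \<le> g m / 2\<close>, so \<open>g\<close> vanishes.\<close>

lemma Lipschitz_ode_unique:
  fixes \<delta> :: "real \<Rightarrow> real"
  assumes s: "s \<in> {0..T}" and t: "t \<in> {0..T}"
    and der: "\<And>t. t \<in> {0..T} \<Longrightarrow> (\<delta> has_real_derivative \<delta>' t) (at t within {0..T})"
    and le: "\<And>t. t \<in> {0..T} \<Longrightarrow> \<bar>\<delta>' t\<bar> \<le> \<bar>\<delta> t\<bar>"
    and 0: "\<delta> s = 0"
  shows "\<delta> t = 0"
proof -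
  define g where "g t = \<bar>\<delta> t\<bar> * exp (- 2 * \<bar>t - s\<bar>)" for t
  have "continuous_on {0..T} \<delta>" using der by (blast intro: DERIV_continuous_on)
  then have "continuous_on {0..T} g" unfolding g_def by (intro continuous_intros)
  then obtain m where m: "m \<in> {0..T}" "\<And>t. t \<in> {0..T} \<Longrightarrow> g t \<le> g m"
    using continuous_attains_sup[of "{0..T}" g] s by auto
  have eq: "\<bar>\<delta> t\<bar> = g t * exp (2 * \<bar>t - s\<bar>)" for t
    by (simp add: g_def exp_minus)
  have "\<bar>\<delta> m - \<delta> s\<bar> \<le> g m / 2 * exp (2 * \<bar>m - s\<bar>)"
  proof (rule exp_weighted_increment_le[OF s m(1) _ der])
    fix t assume t: "t \<in> {0..T}"
    have "\<bar>\<delta>' t\<bar> \<le> g t * exp (2 * \<bar>t - s\<bar>)" using le[OF t] by (simp add: eq)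
    also have "\<dots> \<le> g m * exp (2 * \<bar>t - s\<bar>)" using m(2)[OF t] by simp
    finally show "\<bar>\<delta>' t\<bar> \<le> g m * exp (2 * \<bar>t - s\<bar>)" .
  qed (auto simp: g_def)
  then have "g m * exp (2 * \<bar>m - s\<bar>) \<le> 0" using 0 eq[of m] by simp
  then have "g m \<le> 0" by (simp add: mult_le_0_iff)
  then have "g t \<le> 0" using m(2)[OF t] by linarith
  then show ?thesis by (simp add: g_def zero_less_mult_iff mult_le_0_iff)
qed

text \<open>Gronwall's inequality in comparison form: \<open>B\<close> solves the extremal equation \<open>B' = B + b\<close>.
  The excess of \<open>\<bar>\<delta>\<bar>\<close> over \<open>B\<close>, divided by \<open>exp (2 * t)\<close>, has a maximum \<open>g m\<close>. As
  \<open>\<bar>\<delta>'\<bar> \<le> B' + g m * exp (2 * t)\<close>, integration bounds that excess by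
  \<open>g m / 2 * (exp (2 * m) - 1)\<close> at the time \<open>m\<close>, which forces \<open>g m \<le> 0\<close>.\<close>

lemma Gronwall_supersolution:
  fixes \<delta> B :: "real \<Rightarrow> real"
  assumes t: "t \<in> {0..T}"
    and der: "\<And>t. t \<in> {0..T} \<Longrightarrow> (\<delta> has_real_derivative \<delta>' t) (at t within {0..T})"
    and B: "\<And>t. (B has_real_derivative B t + b t) (at t)"
    and le: "\<And>t. t \<in> {0..T} \<Longrightarrow> \<bar>\<delta>' t\<bar> \<le> \<bar>\<delta> t\<bar> + b t"
    and 0: "\<bar>\<delta> 0\<bar> \<le> B 0"
  shows "\<bar>\<delta> t\<bar> \<le> B t"
proof -
  define g where "g t = (\<bar>\<delta> t\<bar> - B t) * exp (- 2 * t)" for t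
  have "continuous_on {0..T} \<delta>" using der by (blast intro: DERIV_continuous_on)
  moreover have "continuous_on {0..T} B" by (rule DERIV_continuous_on[OF has_field_derivative_at_within[OF B]])
  ultimately have "continuous_on {0..T} g" unfolding g_def by (intro continuous_intros)
  then obtain m where m: "m \<in> {0..T}" "\<And>t. t \<in> {0..T} \<Longrightarrow> g t \<le> g m"
    using continuous_attains_sup[of "{0..T}" g] t by auto
  have eq: "\<bar>\<delta> t\<bar> = B t + g t * exp (2 * t)" for t
    by (simp add: g_def exp_minus field_simps)
  have "\<bar>\<delta> m - \<delta> 0\<bar> \<le> (B m + g m / 2 * exp (2 * m)) - (B 0 + g m / 2 * exp (2 * 0))"
  proof (rule abs_increment_le[OF _ _ der, where k' = "\<lambda>r. (B r + b r) + g m * exp (2 * r)"])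
    fix r assume r: "r \<in> {0..m}"
    have "\<bar>\<delta>' r\<bar> \<le> B r + b r + g r * exp (2 * r)" using le[of r] r m by (simp add: eq)
    also have "\<dots> \<le> B r + b r + g m * exp (2 * r)" using m r by simp
    finally show "\<bar>\<delta>' r\<bar> \<le> B r + b r + g m * exp (2 * r)" .
  next
    fix r assume "r \<in> {0..T}"
    show "((\<lambda>r. B r + g m / 2 * exp (2 * r)) has_real_derivative B r + b r + g m * exp (2 * r)) (at r within {0..m})"
      by (rule derivative_eq_intros has_field_derivative_at_within[OF B] refl)+ simp
  qed (use m in auto)
  moreover have "g m / 2 * exp (2 * m) = g m * exp (2 * m) / 2" by simp
  ultimately have "g m * exp (2 * m) + g m \<le> 0" using 0 eq[of m] by simp
  then have "g m * (exp (2 * m) + 1) \<le> 0" by (simp add: algebra_simps)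
  moreover have "exp (2 * m) + 1 > 0" by (simp add: add_pos_pos)
  ultimately have "g m \<le> 0" by (meson mult_le_0_iff not_less)
  then have "g t \<le> 0" using m(2)[OF t] by linarith
  then show ?thesis by (simp add: g_def mult_le_0_iff)
qed

section \<open>Fubini's theorem for Lebesgue measurable functions\<close>

text \<open>A Lebesgue measurable function has a Borel representative. Integrals over a Lebesgue measurable
  set are thus integrals of Borel functions over the whole space, where the product theorems apply.\<close>

lemma lebesgue_on_eq_lborel_integral:
  fixes f h :: "'a :: euclidean_space \<Rightarrow> real"
  assumes S: "S \<in> sets lebesgue" and h: "h \<in> borel_measurable lborel"
    and eq: "AE z in lborel. indicator S z * f z = h z"
  shows "integrable (lebesgue_on S) f \<longleftrightarrow> integrable lborel h"
    and "(LINT z|lebesgue_on S. f z) = (LINT z|lborel. h z)"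
proof -
  have h': "h \<in> borel_measurable lebesgue" using h by (rule measurable_completion)
  have ae: "AE z in lebesgue. indicator S z * f z = h z" using eq by (rule AE_completion)
  have m: "(\<lambda>z. indicator S z * f z) \<in> borel_measurable lebesgue"
    by (rule borel_measurable_AE[OF h']) (use ae in \<open>auto elim: AE_mp\<close>)
  show "integrable (lebesgue_on S) f \<longleftrightarrow> integrable lborel h"
    using S integrable_cong_AE[OF m h' ae] by (simp add: integrable_restrict_space integrable_completion[OF h])
  show "(LINT z|lebesgue_on S. f z) = (LINT z|lborel. h z)"
    using S integral_cong_AE[OF m h' ae] by (simp add: integral_restrict_space integral_completion[OF h])
qed

text \<open>Lebesgue measure on the product is the completion of the product of the two Borel measures, and
  not the product of their completions. Hence Fubini is applied to a Borel representative \<open>h\<close> of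
  \<open>f\<close>: for almost every \<open>x\<close> the sections of \<open>f\<close> and \<open>h\<close> agree almost everywhere.\<close>

lemma Fubini_lebesgue_on:
  fixes f :: "'a :: euclidean_space \<times> 'b :: euclidean_space \<Rightarrow> real"
  assumes A: "A \<in> sets lebesgue" and B: "B \<in> sets lebesgue" and AB: "A \<times> B \<in> sets lebesgue"
    and f: "integrable (lebesgue_on (A \<times> B)) f"
  shows "integrable (lebesgue_on A) (\<lambda>x. LINT y|lebesgue_on B. f (x, y))"
    and "(LINT x|lebesgue_on A. LINT y|lebesgue_on B. f (x, y)) = (LINT z|lebesgue_on (A \<times> B). f z)"
proof -
  have "(\<lambda>z. indicator (A \<times> B) z * f z) \<in> borel_measurable lebesgue"
    using borel_measurable_integrable[OF f] AB
    by (simp add: borel_measurable_restrict_space_iff)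
  then obtain h where h: "h \<in> borel_measurable lborel"
    and eq: "AE z in lborel. indicator (A \<times> B) z * f z = h z"
    using completion_ex_borel_measurable_real by metis
  note lift = lebesgue_on_eq_lborel_integral[OF AB h eq]
  have h_int: "integrable (lborel \<Otimes>\<^sub>M lborel) h" using lift(1) f by (simp add: lborel_prod)
  note H = lborel_pair.integrable_fst'[OF h_int] lborel_pair.integral_fst'[OF h_int]
  have sect: "(\<lambda>y. h (x, y)) \<in> borel_measurable lborel" for x
    using h by (simp add: lborel_prod[symmetric])
  have "AE x in lborel. AE y in lborel. indicator (A \<times> B) (x, y) * f (x, y) = h (x, y)"
    by (rule lborel_pair.AE_pair) (use eq in \<open>unfold lborel_prod\<close>)
  then have "AE x in lborel. indicator A x * (LINT y|lebesgue_on B. f (x, y)) = (LINT y|lborel. h (x, y))"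
  proof eventually_elim
    case (elim x)
    show ?case
    proof (cases "x \<in> A")
      case True
      have "AE y in lborel. indicator B y * f (x, y) = h (x, y)"
        using elim True by (simp add: indicator_times)
      then show ?thesis
        using True lebesgue_on_eq_lborel_integral(2)[OF B sect[of x]] by simp
    next
      case False
      then have "AE y in lborel. 0 = h (x, y)" using elim by (simp add: indicator_times)
      then have "AE y in lborel. h (x, y) = 0" by eventually_elim simp
      then have "(LINT y|lborel. h (x, y)) = 0" by (rule integral_eq_zero_AE)
      then show ?thesis using False by simp
    qed
  qed
  note outer = lebesgue_on_eq_lborel_integral[OF A borel_measurable_integrable[OF H(1)] this]
  show "integrable (lebesgue_on A) (\<lambda>x. LINT y|lebesgue_on B. f (x, y))"
    using outer(1) H(1) by simp
  show "(LINT x|lebesgue_on A. LINT y|lebesgue_on B. f (x, y)) = (LINT z|lebesgue_on (A \<times> B). f z)"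
    using outer(2) lift(2) H(2) by (simp add: lborel_prod)
qed

section \<open>The circle and families of measures\<close>

lemma to_circle_eq_iff: "to_circle a = to_circle b \<longleftrightarrow> (\<exists>k::int. b = a + of_int k * (2 * pi))"
  by (simp add: circle.abs_eq_iff rcong_altdef)

lemma to_circle_add_multiple: "to_circle (b + of_int k * (2 * pi)) = to_circle b"
  by (metis to_circle_eq_iff)

text \<open>Lipschitz conditions on \<open>\<real>\<close> pass to the circle through representatives that realize the distance.\<close>

lemma ex_lift_dist:
  obtains a b where "to_circle a = u" "to_circle b = v" "\<bar>a - b\<bar> = dist u v"
proof -
  have per: "to_circle (r + 2 * pi) = to_circle r" for r
    using to_circle_add_multiple[of r 1] by simp
  consider "dist u v = \<bar>angle u - angle v\<bar>" | "dist u v = 2 * pi - \<bar>angle u - angle v\<bar>" "angle u \<le> angle v"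
    | "dist u v = 2 * pi - \<bar>angle u - angle v\<bar>" "angle v \<le> angle u"
    unfolding dist_circle_def by linarith
  then show thesis
  proof cases
    case 1 then show thesis by (intro that[of "angle u" "angle v"]) auto
  next
    case 2 then show thesis
      using angle_bounds[of u] angle_bounds[of v]
      by (intro that[of "angle u + 2 * pi" "angle v"]) (auto simp: per)
  next
    case 3 then show thesis
      using angle_bounds[of u] angle_bounds[of v]
      by (intro that[of "angle u" "angle v + 2 * pi"]) (auto simp: per)
  qed
qed

lemma to_circle_minus: "to_circle a - to_circle b = to_circle (a - b)"
  by (simp add: minus_circle.abs_eq)

lemma ae_eq_fibre: "ae_eq (fibre m) (fibre m)"
  by (rule Quotient3_rep_reflp[OF Quotient3_prob_family])

lemma borel_measurable_fibre [measurable]: "fibre m \<in> borel_measurable (lebesgue_on {0..1})"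
  using ae_eq_fibre[of m] by (simp add: ae_eq_def)

lemma dist_prob_family_eq:
  "dist m n = (LINT x|lebesgue_on {0..1}. dist (fibre m x) (fibre n x))"
  by (simp add: dist_prob_family.rep_eq)

lemma integrable_dist_fibre:
  "integrable (lebesgue_on {0..1}) (\<lambda>x. dist (fibre m x) (fibre n x))"
  by (intro integrable_dist_circle_prob borel_measurable_fibre)


section \<open>The velocity field\<close>

locale lipschitz_coupling =
  fixes D :: "circle \<Rightarrow> real"
  assumes D_le: "\<bar>D u\<bar> \<le> 1"
    and D_lip: "\<bar>D (to_circle a) - D (to_circle b)\<bar> \<le> \<bar>a - b\<bar>"
begin

lemma D_shift_le: "\<bar>D (v - to_circle a) - D (v - to_circle b)\<bar> \<le> \<bar>a - b\<bar>"
  using D_lip[of "angle v - a" "angle v - b"] by (simp flip: to_circle_minus)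

lemma Lipschitz_translate: "1-lipschitz_on UNIV (\<lambda>v. D (v - u))"
proof (rule lipschitz_onI)
  fix v w :: circle
  obtain a b where ab: "to_circle a = v" "to_circle b = w" "\<bar>a - b\<bar> = dist v w"
    by (rule ex_lift_dist)
  show "dist (D (v - u)) (D (w - u)) \<le> 1 * dist v w"
    using D_lip[of "a - angle u" "b - angle u"] ab
    by (simp add: dist_real_def flip: to_circle_minus)
qed simp

definition mean_coupling :: "circle \<Rightarrow> circle_prob \<Rightarrow> real" where
  "mean_coupling u m = (LINT v|meas m. D (v - u))"

lemma mean_coupling_le: "\<bar>mean_coupling u m\<bar> \<le> 1"
proof -
  interpret prob_space "meas m" by (rule prob_space_meas)
  have "\<bar>mean_coupling u m\<bar> \<le> (LINT v|meas m. \<bar>D (v - u)\<bar>)"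
    unfolding mean_coupling_def by (rule integral_abs_bound)
  also have "\<dots> \<le> (LINT v|meas m. 1)"
    using D_le integrable_meas_Lipschitz[OF Lipschitz_translate] by (intro integral_mono) auto
  finally show ?thesis by simp
qed

text \<open>The measure enters with constant \<open>1\<close> because \<open>v \<mapsto> D (v - u)\<close> is itself a test function in the
  supremum that defines the distance.\<close>

lemma mean_coupling_diff_le:
  "\<bar>mean_coupling (to_circle a) m - mean_coupling (to_circle b) n\<bar> \<le> \<bar>a - b\<bar> + dist m n"
proof -
  interpret prob_space "meas m" by (rule prob_space_meas)
  note i = integrable_meas_Lipschitz[OF Lipschitz_translate]
  have "\<bar>mean_coupling (to_circle a) m - mean_coupling (to_circle b) m\<bar>
      = \<bar>LINT v|meas m. D (v - to_circle a) - D (v - to_circle b)\<bar>"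
    using i by (simp add: mean_coupling_def)
  also have "\<dots> \<le> (LINT v|meas m. \<bar>D (v - to_circle a) - D (v - to_circle b)\<bar>)"
    by (rule integral_abs_bound)
  also have "\<dots> \<le> (LINT v|meas m. \<bar>a - b\<bar>)"
    using i D_shift_le by (intro integral_mono) auto
  finally have "\<bar>mean_coupling (to_circle a) m - mean_coupling (to_circle b) m\<bar> \<le> \<bar>a - b\<bar>" by simp
  moreover have "\<bar>mean_coupling (to_circle b) m - mean_coupling (to_circle b) n\<bar> \<le> dist m n"
    unfolding mean_coupling_def by (intro Lipschitz_integral_diff_le_dist Lipschitz_translate)
  ultimately show ?thesis by linarith
qed

lemma borel_measurable_mean_coupling [measurable]:
  "(\<lambda>y. mean_coupling u (fibre m y)) \<in> borel_measurable (lebesgue_on {0..1})"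
  unfolding mean_coupling_def
  using borel_measurable_integral_Lipschitz[OF Lipschitz_translate] borel_measurable_fibre
  by (rule measurable_compose[rotated])

end

lemma admissible_kernelD:
  assumes "admissible_kernel W" "x \<in> {0..1}"
  shows "(\<lambda>y. W (x, y)) \<in> borel_measurable (lebesgue_on {0..1})"
    and "\<And>y. y \<in> {0..1} \<Longrightarrow> \<bar>W (x, y)\<bar> \<le> 1"
  using assms by (auto simp: admissible_kernel_def)

lemma integrable_on_unit_bounded:
  fixes f :: "real \<Rightarrow> real"
  assumes "f \<in> borel_measurable (lebesgue_on {0..1})" "\<And>y. y \<in> {0..1} \<Longrightarrow> \<bar>f y\<bar> \<le> B"
  shows "integrable (lebesgue_on {0..1}) f"
proof -
  interpret finite_measure "lebesgue_on {0..1 :: real}" by (rule finite_measure_lebesgue_on_unit)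
  show ?thesis using assms by (intro integrable_const_bound[of _ B]) (auto intro: AE_I2)
qed

lemma integrable_kernel_section_diff:
  assumes W: "admissible_kernel W" and U: "admissible_kernel U" and x: "x \<in> {0..1}"
  shows "integrable (lebesgue_on {0..1}) (\<lambda>y. \<bar>W (x, y) - U (x, y)\<bar>)"
proof -
  note [measurable] = admissible_kernelD(1)[OF W x] admissible_kernelD(1)[OF U x]
  show ?thesis
  proof (rule integrable_on_unit_bounded[where B = 2])
    fix y :: real assume "y \<in> {0..1}"
    then show "\<bar>\<bar>W (x, y) - U (x, y)\<bar>\<bar> \<le> 2"
      using admissible_kernelD(2)[OF W x, of y] admissible_kernelD(2)[OF U x, of y] by linarith
  qed measurable
qed

lemma measure_lebesgue_on_unit [simp]: "measure (lebesgue_on {0..1 :: real}) {0..1} = 1"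
  by (simp add: measure_restrict_space)

context lipschitz_coupling
begin

text \<open>The velocity changes with the phase, the family of measures and the kernel. Writing
  \<open>W A - U B = W (A - B) + (W - U) B\<close> with \<open>\<bar>W\<bar>, \<bar>B\<bar> \<le> 1\<close>, the three changes separate. Two different
  times are allowed, so that \<open>W = U\<close>, \<open>\<mu> = \<nu>\<close> also gives the continuity of the velocity in
  time and its Lipschitz bound in the phase.\<close>

lemma velocity_diff_le:
  assumes W: "admissible_kernel W" and U: "admissible_kernel U" and x: "x \<in> {0..1}"
  shows "\<bar>velocity D W \<mu> (to_circle a) x t - velocity D U \<nu> (to_circle b) x s\<bar>
    \<le> \<bar>a - b\<bar> + dist (\<mu> t) (\<nu> s) + (LINT y|lebesgue_on {0..1}. \<bar>W (x, y) - U (x, y)\<bar>)"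
proof -
  let ?L = "lebesgue_on {0..1 :: real}"
  define A where "A y = mean_coupling (to_circle a) (fibre (\<mu> t) y)" for y
  define B where "B y = mean_coupling (to_circle b) (fibre (\<nu> s) y)" for y
  note [measurable] = admissible_kernelD(1)[OF W x] admissible_kernelD(1)[OF U x]
  have [measurable]: "A \<in> borel_measurable ?L" "B \<in> borel_measurable ?L"
    unfolding A_def B_def by measurable
  have bd: "\<bar>V (x, y) * C y\<bar> \<le> 1" if "admissible_kernel V" "\<bar>C y\<bar> \<le> 1" "y \<in> {0..1}" for V C y
    using admissible_kernelD(2)[OF that(1) x that(3)] that(2) by (simp add: abs_mult mult_le_one)
  have i: "integrable ?L (\<lambda>y. W (x, y) * A y)" "integrable ?L (\<lambda>y. U (x, y) * B y)"
    by (rule integrable_on_unit_bounded[where B = 1], measurable,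
        rule bd, auto simp: W U A_def B_def mean_coupling_le)+
  note j = integrable_kernel_section_diff[OF W U x] integrable_dist_fibre[of "\<mu> t" "\<nu> s"]
  interpret finite_measure ?L by (rule finite_measure_lebesgue_on_unit)
  have "\<bar>velocity D W \<mu> (to_circle a) x t - velocity D U \<nu> (to_circle b) x s\<bar>
      = \<bar>LINT y|?L. W (x, y) * A y - U (x, y) * B y\<bar>"
    using i by (simp add: velocity_def A_def B_def mean_coupling_def)
  also have "\<dots> \<le> (LINT y|?L. \<bar>W (x, y) * A y - U (x, y) * B y\<bar>)" by (rule integral_abs_bound)
  also have "\<dots> \<le> (LINT y|?L. \<bar>a - b\<bar> + dist (fibre (\<mu> t) y) (fibre (\<nu> s) y) + \<bar>W (x, y) - U (x, y)\<bar>)"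
  proof (rule integral_mono)
    fix y assume "y \<in> space ?L"
    then have y: "y \<in> {0..1}" by simp
    have "W (x, y) * A y - U (x, y) * B y = W (x, y) * (A y - B y) + (W (x, y) - U (x, y)) * B y"
      by (simp add: algebra_simps)
    then have "\<bar>W (x, y) * A y - U (x, y) * B y\<bar> \<le> \<bar>W (x, y)\<bar> * \<bar>A y - B y\<bar> + \<bar>W (x, y) - U (x, y)\<bar> * \<bar>B y\<bar>"
      by (metis abs_mult abs_triangle_ineq)
    also have "\<dots> \<le> 1 * \<bar>A y - B y\<bar> + \<bar>W (x, y) - U (x, y)\<bar> * 1"
      using admissible_kernelD(2)[OF W x y]
      by (intro add_mono mult_mono) (auto simp: B_def mean_coupling_le)
    finally show "\<bar>W (x, y) * A y - U (x, y) * B y\<bar>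
        \<le> \<bar>a - b\<bar> + dist (fibre (\<mu> t) y) (fibre (\<nu> s) y) + \<bar>W (x, y) - U (x, y)\<bar>"
      using mean_coupling_diff_le[of a "fibre (\<mu> t) y" b "fibre (\<nu> s) y"] by (simp add: A_def B_def)
  qed (use i j in auto)
  also have "\<dots> = \<bar>a - b\<bar> + dist (\<mu> t) (\<nu> s) + (LINT y|?L. \<bar>W (x, y) - U (x, y)\<bar>)"
    using j by (simp add: dist_prob_family_eq)
  finally show ?thesis .
qed

end


section \<open>The flow of the characteristics\<close>

locale characteristic_flow = lipschitz_coupling +
  fixes T :: real and W :: "real \<times> real \<Rightarrow> real" and \<mu> :: "real \<Rightarrow> prob_family" and x :: real
  assumes T_nonneg: "T \<ge> 0" and W: "admissible_kernel W" and x: "x \<in> {0..1}"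
    and \<mu>_cont: "continuous_on {0..T} \<mu>"
begin

lemma velocity_Lipschitz:
  "\<bar>velocity D W \<mu> (to_circle a) x t - velocity D W \<mu> (to_circle b) x t\<bar> \<le> \<bar>a - b\<bar>"
  using velocity_diff_le[OF W W x, of \<mu> a t \<mu> b t] by simp

lemma velocity_continuous: "continuous_on {0..T} (\<lambda>t. velocity D W \<mu> (to_circle a) x t)"
  unfolding continuous_on_def
proof
  fix t assume t: "t \<in> {0..T}"
  have lim: "((\<lambda>s. dist (\<mu> s) (\<mu> t)) \<longlongrightarrow> 0) (at t within {0..T})"
    using \<mu>_cont t by (auto simp: continuous_on_def intro: tendsto_dist_iff[THEN iffD1])
  have "((\<lambda>s. velocity D W \<mu> (to_circle a) x s - velocity D W \<mu> (to_circle a) x t) \<longlongrightarrow> 0) (at t within {0..T})"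
    by (rule Lim_null_comparison[OF _ lim])
       (use velocity_diff_le[OF W W x, of \<mu> a _ \<mu> a t] in simp)
  then show "((\<lambda>s. velocity D W \<mu> (to_circle a) x s) \<longlongrightarrow> velocity D W \<mu> (to_circle a) x t) (at t within {0..T})"
    by (simp add: LIM_zero_iff)
qed

definition lift_solution :: "(real \<Rightarrow> real) \<Rightarrow> bool" where
  "lift_solution \<theta> \<longleftrightarrow>
     (\<forall>t\<in>{0..T}. (\<theta> has_real_derivative velocity D W \<mu> (to_circle (\<theta> t)) x t) (at t within {0..T}))"

lemma characteristic_iff_lift:
  "characteristic D T W \<mu> x u \<longleftrightarrow> (\<exists>\<theta>. lift_solution \<theta> \<and> (\<forall>t\<in>{0..T}. u t = to_circle (\<theta> t)))"
  unfolding characteristic_def lift_solution_def by (intro arg_cong[where f = Ex] ext) auto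

lemma lift_solution_exists:
  assumes "s \<in> {0..T}"
  obtains \<theta> where "lift_solution \<theta>" "\<theta> s = a"
  unfolding lift_solution_def
  using Lipschitz_ode_exists[OF T_nonneg assms, of "\<lambda>t a. velocity D W \<mu> (to_circle a) x t" a]
    velocity_Lipschitz velocity_continuous by metis

lemma lift_solution_add_multiple:
  assumes "lift_solution \<theta>"
  shows "lift_solution (\<lambda>t. \<theta> t + of_int k * (2 * pi))"
  using assms by (auto simp: lift_solution_def to_circle_add_multiple intro!: derivative_eq_intros)

text \<open>Two lifts that start at the same point of the circle may start at different reals;
  shifting one of them by a multiple of \<open>2\<pi>\<close> reduces the claim to uniqueness on the line.\<close>

lemma lift_solution_unique:
  assumes \<theta>: "lift_solution \<theta>" and \<eta>: "lift_solution \<eta>" and s: "s \<in> {0..T}" and t: "t \<in> {0..T}"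
    and eq: "to_circle (\<theta> s) = to_circle (\<eta> s)"
  shows "to_circle (\<theta> t) = to_circle (\<eta> t)"
proof -
  obtain k :: int where k: "\<theta> s = \<eta> s + of_int k * (2 * pi)" using eq to_circle_eq_iff by metis
  define \<zeta> where "\<zeta> t = \<eta> t + of_int k * (2 * pi)" for t
  have \<zeta>: "lift_solution \<zeta>" unfolding \<zeta>_def by (rule lift_solution_add_multiple[OF \<eta>])
  have "\<theta> t - \<zeta> t = 0"
  proof (rule Lipschitz_ode_unique[OF s t])
    show "((\<lambda>t. \<theta> t - \<zeta> t) has_real_derivative
        velocity D W \<mu> (to_circle (\<theta> t)) x t - velocity D W \<mu> (to_circle (\<zeta> t)) x t) (at t within {0..T})"
      if "t \<in> {0..T}" for t
      using \<theta> \<zeta> that unfolding lift_solution_def by (intro derivative_intros) auto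
  qed (use k velocity_Lipschitz in \<open>auto simp: \<zeta>_def\<close>)
  then show ?thesis by (simp add: \<zeta>_def to_circle_add_multiple)
qed

text \<open>By uniqueness of characteristics, the definite description in the definition of the flow
  denotes a point.\<close>

lemma flow_lift:
  assumes \<theta>: "lift_solution \<theta>" and s: "s \<in> {0..T}" and t: "t \<in> {0..T}"
  shows "flow D T W \<mu> x t s (to_circle (\<theta> s)) = to_circle (\<theta> t)"
  unfolding flow_def
proof (rule the_equality)
  show "\<exists>u. characteristic D T W \<mu> x u \<and> u s = to_circle (\<theta> s) \<and> u t = to_circle (\<theta> t)"
    unfolding characteristic_iff_lift using \<theta> by (intro exI[of _ "\<lambda>r. to_circle (\<theta> r)"]) auto
next
  fix w assume "\<exists>u. characteristic D T W \<mu> x u \<and> u s = to_circle (\<theta> s) \<and> u t = w"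
  then obtain \<eta> where "lift_solution \<eta>" "to_circle (\<theta> s) = to_circle (\<eta> s)" "w = to_circle (\<eta> t)"
    using s t unfolding characteristic_iff_lift by metis
  then show "w = to_circle (\<theta> t)" using lift_solution_unique[OF \<theta> _ s t] by metis
qed

lemma flow_inverse:
  assumes s: "s \<in> {0..T}" and t: "t \<in> {0..T}"
  shows "flow D T W \<mu> x s t (flow D T W \<mu> x t s v) = v"
proof -
  obtain \<theta> where "lift_solution \<theta>" "\<theta> s = angle v" using lift_solution_exists[OF s] by metis
  then show ?thesis using flow_lift[of \<theta>] s t by (metis to_circle_angle)
qed

end

text \<open>The right-hand side solves \<open>B' = B + M * exp (2 * t) + w\<close>, where \<open>w\<close> is the integral
  of \<open>\<bar>W (x, y) - U (x, y)\<bar>\<close> over \<open>y\<close>: by the velocity estimate this dominates the growth of the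
  distance between two characteristics.
  The distance of the driving families is assumed to be bounded by \<open>M * exp (2 * s)\<close> since such a
  bound reproduces itself with a surplus of \<open>M * exp t\<close>, which pays for the difference of the kernels.\<close>

lemma lift_solution_stability:
  assumes D: "lipschitz_coupling D"
    and \<theta>: "characteristic_flow D T W \<mu> x" "characteristic_flow.lift_solution D T W \<mu> x \<theta>"
    and \<eta>: "characteristic_flow D T U \<nu> x" "characteristic_flow.lift_solution D T U \<nu> x \<eta>"
    and dist: "\<And>s. s \<in> {0..T} \<Longrightarrow> dist (\<mu> s) (\<nu> s) \<le> M * exp (2 * s)"
    and t: "t \<in> {0..T}"
  shows "\<bar>\<theta> t - \<eta> t\<bar> \<le> \<bar>\<theta> 0 - \<eta> 0\<bar> * exp t + M * (exp (2 * t) - exp t)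
    + (LINT y|lebesgue_on {0..1}. \<bar>W (x, y) - U (x, y)\<bar>) * (exp t - 1)"
proof -
  interpret \<theta>: characteristic_flow D T W \<mu> x by fact
  interpret \<eta>: characteristic_flow D T U \<nu> x by fact
  let ?w = "LINT y|lebesgue_on {0..1}. \<bar>W (x, y) - U (x, y)\<bar>"
  let ?B = "\<lambda>t. \<bar>\<theta> 0 - \<eta> 0\<bar> * exp t + M * (exp (2 * t) - exp t) + ?w * (exp t - 1)"
  show ?thesis
  proof (rule Gronwall_supersolution[where B = ?B and b = "\<lambda>t. M * exp (2 * t) + ?w", OF t])
    fix t assume "t \<in> {0..T}"
    then show "((\<lambda>t. \<theta> t - \<eta> t) has_real_derivative
        velocity D W \<mu> (to_circle (\<theta> t)) x t - velocity D U \<nu> (to_circle (\<eta> t)) x t) (at t within {0..T})"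
      using \<theta> \<eta> unfolding \<theta>.lift_solution_def \<eta>.lift_solution_def by (intro derivative_intros) auto
  next
    show "(?B has_real_derivative ?B t + (M * exp (2 * t) + ?w)) (at t)" for t
      by (auto intro!: derivative_eq_intros simp: algebra_simps)
  next
    fix t assume "t \<in> {0..T}"
    then show "\<bar>velocity D W \<mu> (to_circle (\<theta> t)) x t - velocity D U \<nu> (to_circle (\<eta> t)) x t\<bar>
        \<le> \<bar>\<theta> t - \<eta> t\<bar> + (M * exp (2 * t) + ?w)"
      using \<theta>.velocity_diff_le[OF \<theta>.W \<eta>.W \<theta>.x, of \<mu> "\<theta> t" t \<nu> "\<eta> t" t] dist[of t] by simp
  qed simp
qed

context characteristic_flow
begin

text \<open>The stability estimate for one kernel and one family; only the measurability
  of the flow will be drawn from it.\<close>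

lemma flow_Lipschitz:
  assumes t: "t \<in> {0..T}"
  shows "(exp t)-lipschitz_on UNIV (flow D T W \<mu> x t 0)"
proof (rule lipschitz_onI)
  fix v w :: circle
  obtain a b where ab: "to_circle a = v" "to_circle b = w" "\<bar>a - b\<bar> = dist v w"
    by (rule ex_lift_dist)
  have 0: "0 \<in> {0..T}" using T_nonneg by simp
  obtain \<theta> \<eta> where \<theta>: "lift_solution \<theta>" "\<theta> 0 = a" and \<eta>: "lift_solution \<eta>" "\<eta> 0 = b"
    using lift_solution_exists[OF 0] by metis
  have "\<bar>\<theta> t - \<eta> t\<bar> \<le> \<bar>\<theta> 0 - \<eta> 0\<bar> * exp t"
    using lift_solution_stability[where M = 0 and T = T and D = D and W = W and U = W and \<mu> = \<mu> and \<nu> = \<mu>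
        and x = x and \<theta> = \<theta> and \<eta> = \<eta> and t = t]
      lipschitz_coupling_axioms characteristic_flow_axioms \<theta> \<eta> t by simp
  then show "dist (flow D T W \<mu> x t 0 v) (flow D T W \<mu> x t 0 w) \<le> exp t * dist v w"
    using flow_lift[OF \<theta>(1) 0 t] flow_lift[OF \<eta>(1) 0 t] dist_to_circle_le[of "\<theta> t" "\<eta> t"] ab \<theta>(2) \<eta>(2)
    by (simp add: mult.commute)
qed simp

lemma borel_measurable_flow:
  assumes t: "t \<in> {0..T}"
  shows "flow D T W \<mu> x t 0 \<in> borel_measurable borel"
  using flow_Lipschitz[OF t] by (intro borel_measurable_continuous_onI lipschitz_on_continuous_on)

lemma flow_image_eq_vimage:
  assumes t: "t \<in> {0..T}"
  shows "flow D T W \<mu> x 0 t ` A = flow D T W \<mu> x t 0 -` A"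
proof -
  have 0: "0 \<in> {0..T}" using T_nonneg by simp
  show ?thesis
  proof (intro set_eqI iffI)
    fix w assume "w \<in> flow D T W \<mu> x 0 t ` A"
    then show "w \<in> flow D T W \<mu> x t 0 -` A" using flow_inverse[OF t 0] by auto
  next
    fix w assume "w \<in> flow D T W \<mu> x t 0 -` A"
    then show "w \<in> flow D T W \<mu> x 0 t ` A"
      using flow_inverse[OF 0 t, of w] by (intro image_eqI[of _ _ "flow D T W \<mu> x t 0 w"]) auto
  qed
qed

text \<open>The fixed point equation evaluates the initial measure on images under the backward flow, which
  are preimages under the forward flow.\<close>

lemma pushforward_by_flow:
  assumes t: "t \<in> {0..T}"
    and eq: "\<forall>A\<in>sets borel. emeasure (meas m) A = emeasure (meas m\<^sub>0) (flow D T W \<mu> x 0 t ` A)"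
  shows "meas m = distr (meas m\<^sub>0) borel (flow D T W \<mu> x t 0)"
proof (rule measure_eqI)
  have meas: "flow D T W \<mu> x t 0 \<in> measurable (meas m\<^sub>0) borel"
    using borel_measurable_flow[OF t] measurable_cong_sets[OF sets_meas refl] by blast
  show "emeasure (meas m) A = emeasure (distr (meas m\<^sub>0) borel (flow D T W \<mu> x t 0)) A"
    if "A \<in> sets (meas m)" for A
    using eq that by (simp add: sets_meas emeasure_distr[OF meas] flow_image_eq_vimage[OF t])
qed (simp add: sets_meas)

end

text \<open>Both measures are images of the same measure, so pairing \<open>\<Phi> v\<close> with \<open>\<Psi> v\<close> is a transport between
  them that moves no mass farther than \<open>C\<close>.\<close>

lemma dist_pushforward_le:
  assumes m: "meas m = distr (meas m\<^sub>0) borel \<Phi>" and n: "meas n = distr (meas m\<^sub>0) borel \<Psi>"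
    and \<Phi>: "\<Phi> \<in> borel_measurable borel" and \<Psi>: "\<Psi> \<in> borel_measurable borel"
    and le: "\<And>v. dist (\<Phi> v) (\<Psi> v) \<le> C"
  shows "dist m n \<le> C"
proof (rule dist_circle_prob_leI)
  fix f :: "circle \<Rightarrow> real" assume f: "1-lipschitz_on UNIV f"
  interpret prob_space "meas m\<^sub>0" by (rule prob_space_meas)
  have f_meas: "f \<in> borel_measurable borel"
    using f by (intro borel_measurable_continuous_onI lipschitz_on_continuous_on)
  have meas: "\<Phi> \<in> measurable (meas m\<^sub>0) borel" "\<Psi> \<in> measurable (meas m\<^sub>0) borel"
    using \<Phi> \<Psi> measurable_cong_sets[OF sets_meas refl] by blast+
  have i: "integrable (meas m\<^sub>0) (\<lambda>v. f (\<Phi> v))" "integrable (meas m\<^sub>0) (\<lambda>v. f (\<Psi> v))"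
    using integrable_meas_Lipschitz[OF f, of m] integrable_meas_Lipschitz[OF f, of n]
    unfolding m n by (simp_all only: integrable_distr_eq[OF meas(1) f_meas] integrable_distr_eq[OF meas(2) f_meas])
  have "\<bar>(LINT v|meas m. f v) - (LINT v|meas n. f v)\<bar> = \<bar>LINT v|meas m\<^sub>0. f (\<Phi> v) - f (\<Psi> v)\<bar>"
    using i unfolding m n by (simp add: integral_distr[OF meas(1) f_meas] integral_distr[OF meas(2) f_meas])
  also have "\<dots> \<le> (LINT v|meas m\<^sub>0. \<bar>f (\<Phi> v) - f (\<Psi> v)\<bar>)" by (rule integral_abs_bound)
  also have "\<dots> \<le> (LINT v|meas m\<^sub>0. C)"
  proof (rule integral_mono)
    fix v
    show "\<bar>f (\<Phi> v) - f (\<Psi> v)\<bar> \<le> C"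
      using lipschitz_onD[OF f, of "\<Phi> v" "\<Psi> v"] le[of v] by (simp add: dist_real_def)
  qed (use i in auto)
  finally show "\<bar>(LINT v|meas m. f v) - (LINT v|meas n. f v)\<bar> \<le> C" by simp
qed


section \<open>Stability of the fixed point\<close>

lemma dist_solution_fibres_le:
  assumes W: "characteristic_flow D T W \<mu> x" and U: "characteristic_flow D T U \<nu> x"
    and t: "t \<in> {0..T}"
    and m: "\<forall>A\<in>sets borel. emeasure (meas m) A = emeasure (meas m\<^sub>0) (flow D T W \<mu> x 0 t ` A)"
    and n: "\<forall>A\<in>sets borel. emeasure (meas n) A = emeasure (meas m\<^sub>0) (flow D T U \<nu> x 0 t ` A)"
    and dist: "\<And>s. s \<in> {0..T} \<Longrightarrow> dist (\<mu> s) (\<nu> s) \<le> M * exp (2 * s)"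
  shows "dist m n \<le> M * (exp (2 * t) - exp t)
    + (LINT y|lebesgue_on {0..1}. \<bar>W (x, y) - U (x, y)\<bar>) * (exp t - 1)"
proof -
  interpret W: characteristic_flow D T W \<mu> x by fact
  interpret U: characteristic_flow D T U \<nu> x by fact
  have 0: "0 \<in> {0..T}" using W.T_nonneg by simp
  show ?thesis
  proof (rule dist_pushforward_le)
    show "meas m = distr (meas m\<^sub>0) borel (flow D T W \<mu> x t 0)" by (rule W.pushforward_by_flow[OF t m])
    show "meas n = distr (meas m\<^sub>0) borel (flow D T U \<nu> x t 0)" by (rule U.pushforward_by_flow[OF t n])
    fix v
    obtain \<theta> where \<theta>: "W.lift_solution \<theta>" "\<theta> 0 = angle v" by (rule W.lift_solution_exists[OF 0])
    obtain \<eta> where \<eta>: "U.lift_solution \<eta>" "\<eta> 0 = angle v" by (rule U.lift_solution_exists[OF 0])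
    have "dist (flow D T W \<mu> x t 0 v) (flow D T U \<nu> x t 0 v) = dist (to_circle (\<theta> t)) (to_circle (\<eta> t))"
      using W.flow_lift[OF \<theta>(1) 0 t] U.flow_lift[OF \<eta>(1) 0 t] \<theta>(2) \<eta>(2) by simp
    also have "\<dots> \<le> \<bar>\<theta> t - \<eta> t\<bar>" by (rule dist_to_circle_le)
    also have "\<dots> \<le> M * (exp (2 * t) - exp t)
        + (LINT y|lebesgue_on {0..1}. \<bar>W (x, y) - U (x, y)\<bar>) * (exp t - 1)"
      using lift_solution_stability[OF W.lipschitz_coupling_axioms W \<theta>(1) U \<eta>(1) dist t] \<theta>(2) \<eta>(2) by simp
    finally show "dist (flow D T W \<mu> x t 0 v) (flow D T U \<nu> x t 0 v) \<le> \<dots>" .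
  qed (rule W.borel_measurable_flow[OF t] U.borel_measurable_flow[OF t])+
qed

lemma integrable_kernel_diff:
  assumes W: "admissible_kernel W" and U: "admissible_kernel U"
  shows "integrable (lebesgue_on ({0..1} \<times> {0..1})) (\<lambda>z. \<bar>W z - U z\<bar>)"
proof -
  let ?S = "{0..1} \<times> {0..1} :: (real \<times> real) set"
  have S: "?S = cbox (0, 0) (1, 1)" by (simp add: cbox_Pair_eq)
  interpret finite_measure "lebesgue_on ?S"
    by (rule finite_measureI)
       (use emeasure_lborel_cbox_finite[of "(0, 0) :: real \<times> real" "(1, 1)"] in
         \<open>simp add: S emeasure_restrict_space space_restrict_space\<close>)
  have [measurable]: "W \<in> borel_measurable (lebesgue_on ?S)" "U \<in> borel_measurable (lebesgue_on ?S)"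
    using W U by (auto simp: admissible_kernel_def)
  show ?thesis
  proof (rule integrable_const_bound[where B = 2])
    have "\<bar>\<bar>W z - U z\<bar>\<bar> \<le> 2" if "z \<in> ?S" for z
    proof -
      have "\<bar>W (fst z, snd z)\<bar> \<le> 1" "\<bar>U (fst z, snd z)\<bar> \<le> 1"
        using that admissible_kernelD(2)[OF W, of "fst z" "snd z"]
          admissible_kernelD(2)[OF U, of "fst z" "snd z"] by (auto simp: mem_Times_iff)
      then show ?thesis by simp
    qed
    then show "AE z in lebesgue_on ?S. norm \<bar>W z - U z\<bar> \<le> 2" by (intro AE_I2) simp
  qed measurable
qed

theorem lemma2p7:
  fixes D :: "circle \<Rightarrow> real"
    and T :: real
    and W U :: "real \<times> real \<Rightarrow> real"
    and \<mu>\<^sub>0 :: prob_family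
    and \<mu> \<nu> :: "real \<Rightarrow> prob_family"
  assumes "\<And>u. \<bar>D u\<bar> \<le> 1"
    and "\<And>a b :: real. \<bar>D (to_circle a) - D (to_circle b)\<bar> \<le> \<bar>a - b\<bar>"
    and "T > 0"
    and "admissible_kernel W"
    and "admissible_kernel U"
    and "fixed_point_solution D T W \<mu>\<^sub>0 \<mu>"
    and "fixed_point_solution D T U \<mu>\<^sub>0 \<nu>"
  shows "(SUP t\<in>{0..T}. dist (\<mu> t) (\<nu> t))
    \<le> exp (2 * T) * (LINT z|lebesgue_on ({0..1} \<times> {0..1}). \<bar>W z - U z\<bar>)"
proof -
  note W = assms(4) and U = assms(5)
  let ?L = "lebesgue_on {0..1 :: real}"
  define c where "c = (LINT z|lebesgue_on ({0..1} \<times> {0..1}). \<bar>W z - U z\<bar>)"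
  define w where "w x = (LINT y|?L. \<bar>W (x, y) - U (x, y)\<bar>)" for x
  have square: "{0..1} \<times> {0..1} \<in> sets (lebesgue :: (real \<times> real) measure)"
    using lmeasurable_cbox[of "(0, 0) :: real \<times> real" "(1, 1)"] by (simp add: cbox_Pair_eq)
  have w: "integrable ?L w" "(LINT x|?L. w x) = c"
    unfolding w_def c_def
    using Fubini_lebesgue_on[OF _ _ square integrable_kernel_diff[OF W U]] by simp_all
  have cont: "continuous_on {0..T} \<mu>" "continuous_on {0..T} \<nu>"
    using assms(6,7) by (auto simp: fixed_point_solution_def)
  interpret lipschitz_coupling D using assms(1,2) by unfold_locales
  have flow: "characteristic_flow D T W \<mu> x" "characteristic_flow D T U \<nu> x" if "x \<in> {0..1}" for x
    using assms(3) W U cont that by unfold_locales auto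
  \<comment> \<open>With \<open>M = g m\<close> the largest value of \<open>g\<close>, the distance at time \<open>t\<close> is at most \<open>M * exp (2 * t)\<close>,
    with equality at \<open>m\<close>.\<close>
  define g where "g t = dist (\<mu> t) (\<nu> t) * exp (- 2 * t)" for t
  have "continuous_on {0..T} g" unfolding g_def by (intro continuous_intros cont)
  then obtain m where m: "m \<in> {0..T}" "\<And>t. t \<in> {0..T} \<Longrightarrow> g t \<le> g m"
    using continuous_attains_sup[of "{0..T}" g] assms(3) by auto
  have eq: "dist (\<mu> t) (\<nu> t) = g t * exp (2 * t)" for t
    by (simp add: g_def exp_minus)
  have le: "dist (\<mu> t) (\<nu> t) \<le> g m * exp (2 * t)" if "t \<in> {0..T}" for t
    using m(2)[OF that] by (simp add: eq)
  have fix_pt: "AE x in ?L. \<forall>A\<in>sets borel.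
        emeasure (meas (fibre (\<mu> m) x)) A = emeasure (meas (fibre \<mu>\<^sub>0 x)) (flow D T W \<mu> x 0 m ` A)"
      "AE x in ?L. \<forall>A\<in>sets borel.
        emeasure (meas (fibre (\<nu> m) x)) A = emeasure (meas (fibre \<mu>\<^sub>0 x)) (flow D T U \<nu> x 0 m ` A)"
    using assms(6,7) m(1) by (auto simp: fixed_point_solution_def)
  have "AE x in ?L. x \<in> {0..1}" by (intro AE_I2) simp
  with fix_pt have ae: "AE x in ?L. dist (fibre (\<mu> m) x) (fibre (\<nu> m) x)
      \<le> g m * (exp (2 * m) - exp m) + w x * (exp m - 1)"
    by eventually_elim (unfold w_def, rule dist_solution_fibres_le[OF flow m(1) _ _ le])
  interpret finite_measure ?L by (rule finite_measure_lebesgue_on_unit)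
  have "dist (\<mu> m) (\<nu> m) \<le> (LINT x|?L. g m * (exp (2 * m) - exp m) + w x * (exp m - 1))"
    unfolding dist_prob_family_eq
    by (rule integral_mono_AE[OF integrable_dist_fibre _ ae]) (use w(1) in simp)
  also have "\<dots> = g m * (exp (2 * m) - exp m) + c * (exp m - 1)" using w by simp
  \<comment> \<open>The left-hand side is \<open>M * exp (2 * m)\<close>, which cancels against the leading term on the right.\<close>
  finally have "g m * exp m \<le> c * exp m - c" by (simp add: eq algebra_simps)
  moreover have c_nonneg: "c \<ge> 0" unfolding c_def by (rule integral_nonneg_AE) simp
  ultimately have "g m * exp m \<le> c * exp m" by linarith
  then have gm: "g m \<le> c" by simp
  have "(SUP t\<in>{0..T}. dist (\<mu> t) (\<nu> t)) \<le> exp (2 * T) * c"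
  proof (rule cSUP_least)
    fix t assume t: "t \<in> {0..T}"
    have "dist (\<mu> t) (\<nu> t) \<le> g m * exp (2 * t)" by (rule le[OF t])
    also have "\<dots> \<le> c * exp (2 * T)" using gm c_nonneg t by (intro mult_mono) auto
    finally show "dist (\<mu> t) (\<nu> t) \<le> exp (2 * T) * c" by (simp add: mult.commute)
  qed (use assms(3) in auto)
  then show ?thesis by (simp add: c_def)
qed

end
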